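(* $\mathsf{RCA}_0\nvdash \mathsf{POS}\rightarrow \mathsf{G}_\delta\text{-}\mathsf{REG}$ and $\mathsf{RCA}_0\nvdash \mathsf{G}_\delta\text{-}\epsilon\rightarrow \mathsf{G}_\delta\text{-}\mathsf{REG}$.
   Context: $\mathsf{RCA}_0$ is the usual base system of reverse mathematics (recursive comprehension and $\Sigma^0_1$ induction) in second order arithmetic. The following definitions are made in $\mathsf{RCA}_0$. Open sets: a code for an open set in $2^{\mathbb N}$ is a set $O\subseteq 2^{<\mathbb N}$ (without loss of generality prefix-free); $X\in[O]$ iff some $\tau\in O$ is an initial segment of $X$. Let $O_t=\{\tau\in O: |\tau|<t\}$ and let $\mu(O_t)=\sum_{\tau\in O_t}2^{-|\tau|}$ (for prefix-free $O$; in general the measure of the clopen set $[O_t]$). For $q\in\mathbb Q$: $\mu(O)\le q$ iff $\forall t\,(\mu(O_t)\le q)$; $\mu(O)>q$ iff $\exists t\,(\mu(O_t)>q)$; $\mu(O)\ge q$ iff $\mu(O)>r$ for all rational $r<q$. Closed sets: a closed set is given by a code $O$ for its open complement; $X\in[O]^c$ iff no $\tau\in O$ is an initial segment of $X$; $\mu([O]^c)\ge q$ iff $\mu(O)\le 1-q$, and similarly for the other inequalities. $G_\delta$ sets: a code is a sequence $G=\langle G_k: k\in\mathbb N\rangle$ of codes for open sets; $X\in[G]$ iff $X\in[G_k]$ for all $k$. With $G^n=\bigcap_{k\le n}G_k$ (an open set), $\mu(G)\le q$ iff for every rational $r>q$ there is $n$ with $\mu(G^n)\le r$; $\mu(G)\ge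 q$ iff $\mu(G^n)\ge q$ for all $n$. $F_\sigma$ sets: a code is a sequence $F=\langle F_n:n\in\mathbb N\rangle$ of codes for open sets; $X\in[F]$ iff $X\in[F_n]^c$ for some $n$. Measure inequalities for $F$ are defined from those of its $G_\delta$ complement (so $\mu(F)\ge q$ iff $\mu(F^c)\le 1-q$). Measures are not assumed to exist as reals: $\mu(P)=\mu(Q)$ abbreviates "for all $q\in\mathbb Q$, $\mu(P)\ge q$ iff $\mu(Q)\ge q$"; $\mu(P)>0$, for $P$ closed or $G_\delta$, means $\mu(P)\ge q$ for some rational $q>0$; $\mu(F)\ge\mu(P)-\epsilon$ means that for all $q\in\mathbb Q$, $\mu(P)\ge q$ implies $\mu(F)\ge q-\epsilon$. Inclusions between coded sets mean inclusion for all $X\subseteq\mathbb N$ (in the model). $\mathsf{G}_\delta\text{-}\mathsf{REG}$: for every $G_\delta$ set $P\subseteq 2^{\mathbb N}$ there is an $F_\sigma$ set $Q\subseteq P$ with $\mu(Q)=\mu(P)$. $\mathsf{G}_\delta\text{-}\epsilon$: for every $G_\delta$ set $P\subseteq 2^{\mathbb N}$ and every (rational) $\epsilon>0$ there is a closed set $F\subseteq P$ with $\mu(F)\ge\mu(P)-\epsilon$. $\mathsf{POS}$: for every $G_\delta$ set $P\subseteq 2^{\mathbb N}$ with $\mu(P)>0$ there is a closed set $F\subseteq P$ with $\mu(F)>0$. *)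

theory Defs
  imports Main
begin

section \<open>The language of second order arithmetic\<close>

text \<open>Two-sorted de Bruijn syntax: number variables and set variables are indexed separately,
  \<open>All\<close> binds number variable 0 and \<open>AllS\<close> binds set variable 0. As usual in second order
  arithmetic, equality of sets is not primitive, and the set terms are the set variables.\<close>

datatype tm = Var nat | Zero | One | Add tm tm | Mul tm tm

datatype fm =
    Fls
  | Eq tm tm
  | Lt tm tm
  | Mem tm nat
  | Imp fm fm
  | All fm
  | AllS fm

abbreviation Neg :: "fm \<Rightarrow> fm" where "Neg \<phi> \<equiv> Imp \<phi> Fls"
abbreviation Or :: "fm \<Rightarrow> fm \<Rightarrow> fm" where "Or \<phi> \<psi> \<equiv> Imp (Neg \<phi>) \<psi>"
abbreviation And :: "fm \<Rightarrow> fm \<Rightarrow> fm" where "And \<phi> \<psi> \<equiv> Neg (Imp \<phi> (Neg \<psi>))"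
abbreviation Iff :: "fm \<Rightarrow> fm \<Rightarrow> fm" where "Iff \<phi> \<psi> \<equiv> And (Imp \<phi> \<psi>) (Imp \<psi> \<phi>)"
abbreviation Ex :: "fm \<Rightarrow> fm" where "Ex \<phi> \<equiv> Neg (All (Neg \<phi>))"
abbreviation ExS :: "fm \<Rightarrow> fm" where "ExS \<phi> \<equiv> Neg (AllS (Neg \<phi>))"

primrec tsub :: "(nat \<Rightarrow> tm) \<Rightarrow> tm \<Rightarrow> tm" where
  "tsub \<sigma> (Var i) = \<sigma> i"
| "tsub \<sigma> Zero = Zero"
| "tsub \<sigma> One = One"
| "tsub \<sigma> (Add s t) = Add (tsub \<sigma> s) (tsub \<sigma> t)"
| "tsub \<sigma> (Mul s t) = Mul (tsub \<sigma> s) (tsub \<sigma> t)"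

abbreviation twk :: "tm \<Rightarrow> tm" where "twk \<equiv> tsub (\<lambda>i. Var (Suc i))"

text \<open>Simultaneous capture-avoiding substitution of terms for number variables and of set
  variables for set variables.\<close>

primrec sub :: "(nat \<Rightarrow> tm) \<Rightarrow> (nat \<Rightarrow> nat) \<Rightarrow> fm \<Rightarrow> fm" where
  "sub \<sigma> \<rho> Fls = Fls"
| "sub \<sigma> \<rho> (Eq s t) = Eq (tsub \<sigma> s) (tsub \<sigma> t)"
| "sub \<sigma> \<rho> (Lt s t) = Lt (tsub \<sigma> s) (tsub \<sigma> t)"
| "sub \<sigma> \<rho> (Mem t X) = Mem (tsub \<sigma> t) (\<rho> X)"
| "sub \<sigma> \<rho> (Imp \<phi> \<psi>) = Imp (sub \<sigma> \<rho> \<phi>) (sub \<sigma> \<rho> \<psi>)"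
| "sub \<sigma> \<rho> (All \<phi>) = All (sub (case_nat (Var 0) (\<lambda>i. twk (\<sigma> i))) \<rho> \<phi>)"
| "sub \<sigma> \<rho> (AllS \<phi>) = AllS (sub \<sigma> (case_nat 0 (\<lambda>i. Suc (\<rho> i))) \<phi>)"

definition inst :: "tm \<Rightarrow> fm \<Rightarrow> fm" where "inst t = sub (case_nat t Var) (\<lambda>X. X)"
definition instS :: "nat \<Rightarrow> fm \<Rightarrow> fm" where "instS Y = sub Var (case_nat Y (\<lambda>X. X))"
definition wk :: "fm \<Rightarrow> fm" where "wk = sub (\<lambda>i. Var (Suc i)) (\<lambda>X. X)"
definition wkS :: "fm \<Rightarrow> fm" where "wkS = sub Var Suc"


section \<open>Provability\<close>

text \<open>A Hilbert calculus for two-sorted classical first order logic. Because of the rules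
  \<open>gen\<close> and \<open>genS\<close>, an open formula in \<open>T\<close> stands for its universal closure.\<close>

inductive prv :: "fm set \<Rightarrow> fm \<Rightarrow> bool" (infix "\<turnstile>" 50) for T :: "fm set" where
  ax: "\<phi> \<in> T \<Longrightarrow> T \<turnstile> \<phi>"
| mp: "T \<turnstile> Imp \<phi> \<psi> \<Longrightarrow> T \<turnstile> \<phi> \<Longrightarrow> T \<turnstile> \<psi>"
| K: "T \<turnstile> Imp \<phi> (Imp \<psi> \<phi>)"
| S: "T \<turnstile> Imp (Imp \<phi> (Imp \<psi> \<chi>)) (Imp (Imp \<phi> \<psi>) (Imp \<phi> \<chi>))"
| dne: "T \<turnstile> Imp (Neg (Neg \<phi>)) \<phi>"
| gen: "T \<turnstile> \<phi> \<Longrightarrow> T \<turnstile> All \<phi>"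
| all_inst: "T \<turnstile> Imp (All \<phi>) (inst t \<phi>)"
| all_imp: "T \<turnstile> Imp (All (Imp \<phi> \<psi>)) (Imp (All \<phi>) (All \<psi>))"
| all_vac: "T \<turnstile> Imp \<phi> (All (wk \<phi>))"
| genS: "T \<turnstile> \<phi> \<Longrightarrow> T \<turnstile> AllS \<phi>"
| allS_inst: "T \<turnstile> Imp (AllS \<phi>) (instS Y \<phi>)"
| allS_imp: "T \<turnstile> Imp (AllS (Imp \<phi> \<psi>)) (Imp (AllS \<phi>) (AllS \<psi>))"
| allS_vac: "T \<turnstile> Imp \<phi> (AllS (wkS \<phi>))"
| eq_refl: "T \<turnstile> Eq t t"
| eq_subst: "T \<turnstile> Imp (Eq s t) (Imp (inst s \<phi>) (inst t \<phi>))"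


section \<open>The base system\<close>

inductive delta0 :: "fm \<Rightarrow> bool" where
  "delta0 Fls"
| "delta0 (Eq s t)"
| "delta0 (Lt s t)"
| "delta0 (Mem t X)"
| "delta0 \<phi> \<Longrightarrow> delta0 \<psi> \<Longrightarrow> delta0 (Imp \<phi> \<psi>)"
| "delta0 \<phi> \<Longrightarrow> delta0 (All (Imp (Lt (Var 0) (twk t)) \<phi>))"

definition sigma1 :: "fm \<Rightarrow> bool" where "sigma1 \<phi> \<longleftrightarrow> (\<exists>\<theta>. delta0 \<theta> \<and> \<phi> = Ex \<theta>)"
definition pi1 :: "fm \<Rightarrow> bool" where "pi1 \<phi> \<longleftrightarrow> (\<exists>\<theta>. delta0 \<theta> \<and> \<phi> = All \<theta>)"

definition basic_axioms :: "fm set" where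
  "basic_axioms =
    (let m = Var 0; n = Var 1 in
     {Neg (Eq (Add n One) Zero),
      Imp (Eq (Add m One) (Add n One)) (Eq m n),
      Eq (Add m Zero) m,
      Eq (Add m (Add n One)) (Add (Add m n) One),
      Eq (Mul m Zero) Zero,
      Eq (Mul m (Add n One)) (Add (Mul m n) m),
      Neg (Lt m Zero),
      Iff (Lt m (Add n One)) (Or (Lt m n) (Eq m n))})"

text \<open>In both schemes variable 0 is the number variable of the scheme; all other free variables
  are parameters.\<close>

definition ind_axiom :: "fm \<Rightarrow> fm" where
  "ind_axiom \<phi> =
    Imp (inst Zero \<phi>)
      (Imp (All (Imp \<phi> (sub (case_nat (Add (Var 0) One) (\<lambda>i. Var (Suc i))) (\<lambda>X. X) \<phi>)))
        (All \<phi>))"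

definition comp_axiom :: "fm \<Rightarrow> fm \<Rightarrow> fm" where
  "comp_axiom \<phi> \<psi> =
    Imp (All (Iff \<phi> \<psi>)) (ExS (All (Iff (Mem (Var 0) 0) (wkS \<phi>))))"

definition RCA0 :: "fm set" where
  "RCA0 = basic_axioms \<union> {ind_axiom \<phi> | \<phi>. sigma1 \<phi>}
     \<union> {comp_axiom \<phi> \<psi> | \<phi> \<psi>. sigma1 \<phi> \<and> pi1 \<psi>}"


section \<open>Writing formulas with named variables\<close>

text \<open>The types below represent terms, set variables and formulas as functions of the number of
  enclosing number and set quantifiers. The binder \<open>\<^bold>\<forall>\<close> passes to its body the de Bruijn index
  that refers to this binder at whatever depth it is used, so that HOL-bound names can serve as
  variables of the formula. A closed \<open>nfm\<close> is turned into a sentence by starting at depth 0.\<close>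

type_synonym ntm = "nat \<Rightarrow> tm"
type_synonym nset = "nat \<Rightarrow> nat"
type_synonym nfm = "nat \<Rightarrow> nat \<Rightarrow> fm"

definition sentence :: "nfm \<Rightarrow> fm" where "sentence \<phi> = \<phi> 0 0"

definition n0 :: ntm ("\<^bold>0") where "\<^bold>0 = (\<lambda>d. Zero)"
definition n1 :: ntm ("\<^bold>1") where "\<^bold>1 = (\<lambda>d. One)"
definition nadd :: "ntm \<Rightarrow> ntm \<Rightarrow> ntm" (infixl "\<^bold>+" 65) where "s \<^bold>+ t = (\<lambda>d. Add (s d) (t d))"
definition nmul :: "ntm \<Rightarrow> ntm \<Rightarrow> ntm" (infixl "\<^bold>*" 70) where "s \<^bold>* t = (\<lambda>d. Mul (s d) (t d))"

definition nfls :: nfm ("\<^bold>\<bottom>") where "\<^bold>\<bottom> = (\<lambda>d e. Fls)"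
definition neq :: "ntm \<Rightarrow> ntm \<Rightarrow> nfm" (infix "\<^bold>=" 50) where
  "s \<^bold>= t = (\<lambda>d e. Eq (s d) (t d))"
definition nlt :: "ntm \<Rightarrow> ntm \<Rightarrow> nfm" (infix "\<^bold><" 50) where
  "s \<^bold>< t = (\<lambda>d e. Lt (s d) (t d))"
definition nmem :: "ntm \<Rightarrow> nset \<Rightarrow> nfm" (infix "\<^bold>\<in>" 50) where
  "t \<^bold>\<in> X = (\<lambda>d e. Mem (t d) (X e))"
definition nimp :: "nfm \<Rightarrow> nfm \<Rightarrow> nfm" (infixr "\<^bold>\<longrightarrow>" 25) where
  "(\<phi> \<^bold>\<longrightarrow> \<psi>) = (\<lambda>d e. Imp (\<phi> d e) (\<psi> d e))"
definition nall :: "(ntm \<Rightarrow> nfm) \<Rightarrow> nfm" (binder "\<^bold>\<forall>" 10) where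
  "nall \<phi> = (\<lambda>d e. All (\<phi> (\<lambda>d'. Var (d' - Suc d)) (Suc d) e))"
definition nallS :: "(nset \<Rightarrow> nfm) \<Rightarrow> nfm" (binder "\<^bold>\<forall>\<^sub>S" 10) where
  "nallS \<phi> = (\<lambda>d e. AllS (\<phi> (\<lambda>e'. e' - Suc e) d (Suc e)))"

definition nneg :: "nfm \<Rightarrow> nfm" ("\<^bold>\<not> _" [40] 40) where "(\<^bold>\<not> \<phi>) = (\<phi> \<^bold>\<longrightarrow> \<^bold>\<bottom>)"
definition nconj :: "nfm \<Rightarrow> nfm \<Rightarrow> nfm" (infixr "\<^bold>\<and>" 35) where
  "(\<phi> \<^bold>\<and> \<psi>) = (\<^bold>\<not> (\<phi> \<^bold>\<longrightarrow> \<^bold>\<not> \<psi>))"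
definition niff :: "nfm \<Rightarrow> nfm \<Rightarrow> nfm" (infixr "\<^bold>\<longleftrightarrow>" 25) where
  "(\<phi> \<^bold>\<longleftrightarrow> \<psi>) = ((\<phi> \<^bold>\<longrightarrow> \<psi>) \<^bold>\<and> (\<psi> \<^bold>\<longrightarrow> \<phi>))"
definition nex :: "(ntm \<Rightarrow> nfm) \<Rightarrow> nfm" (binder "\<^bold>\<exists>" 10) where
  "nex \<phi> = (\<^bold>\<not> (\<^bold>\<forall>x. \<^bold>\<not> \<phi> x))"
definition nexS :: "(nset \<Rightarrow> nfm) \<Rightarrow> nfm" (binder "\<^bold>\<exists>\<^sub>S" 10) where
  "nexS \<phi> = (\<^bold>\<not> (\<^bold>\<forall>\<^sub>S X. \<^bold>\<not> \<phi> X))"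
definition nle :: "ntm \<Rightarrow> ntm \<Rightarrow> nfm" (infix "\<^bold>\<le>" 50) where
  "s \<^bold>\<le> t = (s \<^bold>< t \<^bold>+ \<^bold>1)"


section \<open>Coding in second order arithmetic\<close>

subsection \<open>Finite sequences, binary strings, pairs\<close>

text \<open>Goedel's beta function: \<open>v\<close> is entry \<open>i\<close> of the finite sequence coded by \<open>(c, d)\<close>.\<close>

definition beta :: "ntm \<Rightarrow> ntm \<Rightarrow> ntm \<Rightarrow> ntm \<Rightarrow> nfm" where
  "beta c d i v =
    (\<^bold>\<exists>k. c \<^bold>= k \<^bold>* (\<^bold>1 \<^bold>+ (i \<^bold>+ \<^bold>1) \<^bold>* d) \<^bold>+ v \<^bold>\<and> v \<^bold>< \<^bold>1 \<^bold>+ (i \<^bold>+ \<^bold>1) \<^bold>* d)"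

text \<open>\<open>p = 2\<^sup>k\<close>\<close>

definition pow2 :: "ntm \<Rightarrow> ntm \<Rightarrow> nfm" where
  "pow2 k p =
    (\<^bold>\<exists>c. \<^bold>\<exists>d. beta c d \<^bold>0 \<^bold>1
      \<^bold>\<and> (\<^bold>\<forall>i. i \<^bold>< k \<^bold>\<longrightarrow> (\<^bold>\<exists>v. beta c d i v \<^bold>\<and> beta c d (i \<^bold>+ \<^bold>1) (v \<^bold>+ v)))
      \<^bold>\<and> beta c d k p)"

text \<open>The binary string \<open>\<tau>\<close> is coded by the number with binary digits \<open>1 \<tau>(n-1) \<dots> \<tau>(0)\<close>,
  where \<open>n = |\<tau>|\<close>. So the strings of length \<open>n\<close> are the numbers in \<open>[2\<^sup>n, 2\<^sup>n\<^sup>+\<^sup>1)\<close>, and every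
  number except 0 is a string. \<open>digit \<tau> i\<close> says that \<open>\<tau>(i) = 1\<close>, for \<open>i < |\<tau>|\<close>.\<close>

definition len :: "ntm \<Rightarrow> ntm \<Rightarrow> nfm" where
  "len \<tau> n = (\<^bold>\<exists>p. pow2 n p \<^bold>\<and> p \<^bold>\<le> \<tau> \<^bold>\<and> \<tau> \<^bold>< p \<^bold>+ p)"

definition digit :: "ntm \<Rightarrow> ntm \<Rightarrow> nfm" where
  "digit \<tau> i = (\<^bold>\<exists>p. \<^bold>\<exists>h. \<^bold>\<exists>r. pow2 i p \<^bold>\<and> \<tau> \<^bold>= h \<^bold>* (p \<^bold>+ p) \<^bold>+ p \<^bold>+ r \<^bold>\<and> r \<^bold>< p)"

definition prefix :: "ntm \<Rightarrow> ntm \<Rightarrow> nfm" where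
  "prefix \<tau> \<sigma> =
    (\<^bold>\<exists>m. \<^bold>\<exists>n. len \<tau> m \<^bold>\<and> len \<sigma> n \<^bold>\<and> m \<^bold>\<le> n \<^bold>\<and> (\<^bold>\<forall>i. i \<^bold>< m \<^bold>\<longrightarrow> (digit \<tau> i \<^bold>\<longleftrightarrow> digit \<sigma> i)))"

definition initseg :: "ntm \<Rightarrow> nset \<Rightarrow> nfm" where
  "initseg \<tau> X = (\<^bold>\<exists>n. len \<tau> n \<^bold>\<and> (\<^bold>\<forall>i. i \<^bold>< n \<^bold>\<longrightarrow> (digit \<tau> i \<^bold>\<longleftrightarrow> i \<^bold>\<in> X)))"

definition npair :: "ntm \<Rightarrow> ntm \<Rightarrow> ntm" where
  "npair k n = (k \<^bold>+ n) \<^bold>* (k \<^bold>+ n) \<^bold>+ k"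


subsection \<open>Rationals\<close>

text \<open>The triple \<open>(a, b, c)\<close> represents the rational \<open>(a - b) / (c + 1)\<close>. Quantification over
  rationals is quantification over their representations.\<close>

type_synonym nrat = "ntm \<times> ntm \<times> ntm"

definition nallQ :: "(nrat \<Rightarrow> nfm) \<Rightarrow> nfm" (binder "\<^bold>\<forall>\<^sub>Q" 10) where
  "nallQ \<phi> = (\<^bold>\<forall>a. \<^bold>\<forall>b. \<^bold>\<forall>c. \<phi> (a, b, c))"
definition nexQ :: "(nrat \<Rightarrow> nfm) \<Rightarrow> nfm" (binder "\<^bold>\<exists>\<^sub>Q" 10) where
  "nexQ \<phi> = (\<^bold>\<exists>a. \<^bold>\<exists>b. \<^bold>\<exists>c. \<phi> (a, b, c))"

definition qzero :: nrat where "qzero = (\<^bold>0, \<^bold>0, \<^bold>0)"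

fun qless :: "nrat \<Rightarrow> nrat \<Rightarrow> nfm" where
  "qless (a, b, c) (a', b', c') =
    (a \<^bold>* (c' \<^bold>+ \<^bold>1) \<^bold>+ b' \<^bold>* (c \<^bold>+ \<^bold>1) \<^bold>< a' \<^bold>* (c \<^bold>+ \<^bold>1) \<^bold>+ b \<^bold>* (c' \<^bold>+ \<^bold>1))"

fun one_minus :: "nrat \<Rightarrow> nrat" where
  "one_minus (a, b, c) = (c \<^bold>+ \<^bold>1 \<^bold>+ b, a, c)"

fun qminus :: "nrat \<Rightarrow> nrat \<Rightarrow> nrat" where
  "qminus (a, b, c) (a', b', c') =
    (a \<^bold>* (c' \<^bold>+ \<^bold>1) \<^bold>+ b' \<^bold>* (c \<^bold>+ \<^bold>1), b \<^bold>* (c' \<^bold>+ \<^bold>1) \<^bold>+ a' \<^bold>* (c \<^bold>+ \<^bold>1), c \<^bold>* c' \<^bold>+ c \<^bold>+ c')"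

text \<open>\<open>m / p \<le> q\<close> and \<open>m / p > q\<close>, for \<open>p > 0\<close>\<close>

fun frac_le :: "ntm \<Rightarrow> ntm \<Rightarrow> nrat \<Rightarrow> nfm" where
  "frac_le m p (a, b, c) = (m \<^bold>* (c \<^bold>+ \<^bold>1) \<^bold>+ b \<^bold>* p \<^bold>\<le> a \<^bold>* p)"
fun frac_gt :: "ntm \<Rightarrow> ntm \<Rightarrow> nrat \<Rightarrow> nfm" where
  "frac_gt m p (a, b, c) = (a \<^bold>* p \<^bold>< m \<^bold>* (c \<^bold>+ \<^bold>1) \<^bold>+ b \<^bold>* p)"


subsection \<open>Open sets\<close>

text \<open>A code is given by its membership formula, so that \<open>elts O\<close>, \<open>G\<^sub>k\<close> and \<open>G\<^sup>n\<close> are all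
  treated alike.\<close>

type_synonym ncode = "ntm \<Rightarrow> nfm"

definition elts :: "nset \<Rightarrow> ncode" where "elts U \<tau> = (\<tau> \<^bold>\<in> U)"

definition open_code :: "ncode \<Rightarrow> nfm" where "open_code U = (\<^bold>\<not> U \<^bold>0)"

definition open_mem :: "nset \<Rightarrow> ncode \<Rightarrow> nfm" where
  "open_mem X U = (\<^bold>\<exists>\<tau>. U \<tau> \<^bold>\<and> initseg \<tau> X)"

text \<open>\<open>cover_count U t m p\<close>: \<open>p = 2\<^sup>t\<close>, and exactly \<open>m\<close> of the \<open>p\<close> strings of length \<open>t\<close>
  (the numbers \<open>p + i\<close> with \<open>i < p\<close>) have an initial segment in \<open>U\<^sub>t\<close>. So the clopen set
  \<open>[U\<^sub>t]\<close> has measure \<open>m / p\<close>; codes need not be prefix-free. The sequence coded by \<open>(c, d)\<close>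
  consists of the partial counts.\<close>

definition covered :: "ncode \<Rightarrow> ntm \<Rightarrow> ntm \<Rightarrow> nfm" where
  "covered U t \<sigma> = (\<^bold>\<exists>\<tau>. U \<tau> \<^bold>\<and> (\<^bold>\<exists>n. len \<tau> n \<^bold>\<and> n \<^bold>< t) \<^bold>\<and> prefix \<tau> \<sigma>)"

definition cover_count :: "ncode \<Rightarrow> ntm \<Rightarrow> ntm \<Rightarrow> ntm \<Rightarrow> nfm" where
  "cover_count U t m p =
    (pow2 t p \<^bold>\<and>
     (\<^bold>\<exists>c. \<^bold>\<exists>d. beta c d \<^bold>0 \<^bold>0
       \<^bold>\<and> (\<^bold>\<forall>i. i \<^bold>< p \<^bold>\<longrightarrow>
             (\<^bold>\<exists>v. beta c d i v
               \<^bold>\<and> (covered U t (p \<^bold>+ i) \<^bold>\<longrightarrow> beta c d (i \<^bold>+ \<^bold>1) (v \<^bold>+ \<^bold>1))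
               \<^bold>\<and> (\<^bold>\<not> covered U t (p \<^bold>+ i) \<^bold>\<longrightarrow> beta c d (i \<^bold>+ \<^bold>1) v)))
       \<^bold>\<and> beta c d p m))"

definition open_le :: "ncode \<Rightarrow> nrat \<Rightarrow> nfm" where
  "open_le U q = (\<^bold>\<forall>t. \<^bold>\<exists>m. \<^bold>\<exists>p. cover_count U t m p \<^bold>\<and> frac_le m p q)"

definition open_gt :: "ncode \<Rightarrow> nrat \<Rightarrow> nfm" where
  "open_gt U q = (\<^bold>\<exists>t. \<^bold>\<exists>m. \<^bold>\<exists>p. cover_count U t m p \<^bold>\<and> frac_gt m p q)"

definition open_ge :: "ncode \<Rightarrow> nrat \<Rightarrow> nfm" where
  "open_ge U q = (\<^bold>\<forall>\<^sub>Q r. qless r q \<^bold>\<longrightarrow> open_gt U r)"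


subsection \<open>Closed sets\<close>

definition closed_mem :: "nset \<Rightarrow> nset \<Rightarrow> nfm" where
  "closed_mem X C = (\<^bold>\<not> open_mem X (elts C))"

definition closed_ge :: "nset \<Rightarrow> nrat \<Rightarrow> nfm" where
  "closed_ge C q = open_le (elts C) (one_minus q)"


subsection \<open>\<open>G\<^sub>\<delta>\<close> and \<open>F\<^sub>\<sigma>\<close> sets\<close>

definition component :: "nset \<Rightarrow> ntm \<Rightarrow> ncode" where
  "component G k \<tau> = (npair k \<tau> \<^bold>\<in> G)"

definition seq_code :: "nset \<Rightarrow> nfm" where
  "seq_code G = (\<^bold>\<forall>k. open_code (component G k))"

definition gdelta_mem :: "nset \<Rightarrow> nset \<Rightarrow> nfm" where
  "gdelta_mem X G = (\<^bold>\<forall>k. open_mem X (component G k))"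

text \<open>The code of \<open>G\<^sup>n\<close>: all strings that, for each \<open>k \<le> n\<close>, have an initial segment in \<open>G\<^sub>k\<close>.\<close>

definition finite_inter :: "nset \<Rightarrow> ntm \<Rightarrow> ncode" where
  "finite_inter G n \<sigma> = (\<^bold>\<forall>k. k \<^bold>\<le> n \<^bold>\<longrightarrow> (\<^bold>\<exists>\<tau>. component G k \<tau> \<^bold>\<and> prefix \<tau> \<sigma>))"

definition gdelta_le :: "nset \<Rightarrow> nrat \<Rightarrow> nfm" where
  "gdelta_le G q = (\<^bold>\<forall>\<^sub>Q r. qless q r \<^bold>\<longrightarrow> (\<^bold>\<exists>n. open_le (finite_inter G n) r))"

definition gdelta_ge :: "nset \<Rightarrow> nrat \<Rightarrow> nfm" where
  "gdelta_ge G q = (\<^bold>\<forall>n. open_ge (finite_inter G n) q)"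

text \<open>\<open>F\<close> codes the \<open>F\<^sub>\<sigma>\<close> set whose complement is the \<open>G\<^sub>\<delta>\<close> set with the same code.\<close>

definition fsigma_mem :: "nset \<Rightarrow> nset \<Rightarrow> nfm" where
  "fsigma_mem X F = (\<^bold>\<exists>n. \<^bold>\<not> open_mem X (component F n))"

definition fsigma_ge :: "nset \<Rightarrow> nrat \<Rightarrow> nfm" where
  "fsigma_ge F q = gdelta_le F (one_minus q)"


section \<open>The regularity principles\<close>

definition Gdelta_REG :: fm where
  "Gdelta_REG = sentence
    (\<^bold>\<forall>\<^sub>S P. seq_code P \<^bold>\<longrightarrow>
      (\<^bold>\<exists>\<^sub>S Q. seq_code Q
        \<^bold>\<and> (\<^bold>\<forall>\<^sub>S X. fsigma_mem X Q \<^bold>\<longrightarrow> gdelta_mem X P)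
        \<^bold>\<and> (\<^bold>\<forall>\<^sub>Q q. fsigma_ge Q q \<^bold>\<longleftrightarrow> gdelta_ge P q)))"

definition Gdelta_eps :: fm where
  "Gdelta_eps = sentence
    (\<^bold>\<forall>\<^sub>S P. seq_code P \<^bold>\<longrightarrow>
      (\<^bold>\<forall>\<^sub>Q \<epsilon>. qless qzero \<epsilon> \<^bold>\<longrightarrow>
        (\<^bold>\<exists>\<^sub>S C. open_code (elts C)
          \<^bold>\<and> (\<^bold>\<forall>\<^sub>S X. closed_mem X C \<^bold>\<longrightarrow> gdelta_mem X P)
          \<^bold>\<and> (\<^bold>\<forall>\<^sub>Q q. gdelta_ge P q \<^bold>\<longrightarrow> closed_ge C (qminus q \<epsilon>)))))"

definition POS :: fm where
  "POS = sentence
    (\<^bold>\<forall>\<^sub>S P. seq_code P \<^bold>\<longrightarrow>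
      (\<^bold>\<exists>\<^sub>Q q. qless qzero q \<^bold>\<and> gdelta_ge P q) \<^bold>\<longrightarrow>
      (\<^bold>\<exists>\<^sub>S C. open_code (elts C)
        \<^bold>\<and> (\<^bold>\<forall>\<^sub>S X. closed_mem X C \<^bold>\<longrightarrow> gdelta_mem X P)
        \<^bold>\<and> (\<^bold>\<exists>\<^sub>Q q. qless qzero q \<^bold>\<and> closed_ge C q)))"

end

theory Submission
  imports Defs Complex_Main "HOL-Library.Countable" "HOL-Number_Theory.Cong"
begin

text \<open>Inclusions of coded sets only concern members of the model. In an \<open>\<omega>\<close>-model like that of the
  recursive sets, a diagonal argument gives open sets of arbitrarily small measure that contain
  every set of the model. Their closed complements have no members, so they witness
  \<open>POS\<close> and \<open>Gdelta_eps\<close> vacuously. Regularity, on the other hand, requires equal measures.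
  Let \<open>P\<close> be the union of the cylinders of \<open>0\<^sup>3\<^sup>e1\<close> over \<open>e\<close> in a complete
  \<open>\<Pi>\<^sub>2\<close> set. If \<open>Q\<close> is \<open>F\<^sub>\<sigma>\<close>, then \<open>\<mu>(Q) > q\<close> is \<open>\<Sigma>\<^sub>2\<close>, so that
  \<open>\<mu>(P) = \<mu>(Q)\<close> would make the \<open>\<Pi>\<^sub>2\<close> set \<open>\<Sigma>\<^sub>2\<close>. To have a universal enumeration
  without arithmetizing syntax, recursiveness is taken relative to a
  self-referential oracle.\<close>

section \<open>Semantics and soundness\<close>

text \<open>The measure of \<open>Q\<close> alone does not tell whether e is in the
  \<open>\<Pi>\<^sub>2\<close> set, since smaller indices contribute cylinders too. The
  diagonalization therefore guesses a finite set F of smaller indices. Only the fact that F omits no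
  member needs a certificate: an F that is too large merely raises the measure that \<open>Q\<close>
  would have to reach. The spacing 3 leaves room for a dyadic threshold. If e is a member, its
  cylinder contributes 1/2^(3e+1). If not, everything beyond e lies in the cylinder of 3e+3 zeros
  and contributes at most 1/2^(3e+3). The value 1/2^(3e+2) separates the two cases. No recursion
  theorem is called for, because e is a member iff formula number e holds of [e, n] for all n: a
  formula receives its own number as an argument. For the formula saying that some stage refutes the
  witness n, its number e is a member iff no witness for e survives, whereas equality of measures
  would make e a member iff one survives.\<close>

primrec teval :: "(nat \<Rightarrow> nat) \<Rightarrow> tm \<Rightarrow> nat" where
  "teval \<nu> (Var i) = \<nu> i"
| "teval \<nu> Zero = 0"
| "teval \<nu> One = 1"
| "teval \<nu> (Add s t) = teval \<nu> s + teval \<nu> t"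
| "teval \<nu> (Mul s t) = teval \<nu> s * teval \<nu> t"

primrec sat :: "nat set set \<Rightarrow> (nat \<Rightarrow> nat) \<Rightarrow> (nat \<Rightarrow> nat set) \<Rightarrow> fm \<Rightarrow> bool" where
  "sat M \<nu> \<xi> Fls \<longleftrightarrow> False"
| "sat M \<nu> \<xi> (Eq s t) \<longleftrightarrow> teval \<nu> s = teval \<nu> t"
| "sat M \<nu> \<xi> (Lt s t) \<longleftrightarrow> teval \<nu> s < teval \<nu> t"
| "sat M \<nu> \<xi> (Mem t X) \<longleftrightarrow> teval \<nu> t \<in> \<xi> X"
| "sat M \<nu> \<xi> (Imp \<phi> \<psi>) \<longleftrightarrow> (sat M \<nu> \<xi> \<phi> \<longrightarrow> sat M \<nu> \<xi> \<psi>)"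
| "sat M \<nu> \<xi> (All \<phi>) \<longleftrightarrow> (\<forall>n. sat M (case_nat n \<nu>) \<xi> \<phi>)"
| "sat M \<nu> \<xi> (AllS \<phi>) \<longleftrightarrow> (\<forall>X\<in>M. sat M \<nu> (case_nat X \<xi>) \<phi>)"

lemma teval_tsub: "teval \<nu> (tsub \<sigma> t) = teval (\<lambda>i. teval \<nu> (\<sigma> i)) t"
  by (induction t) auto

lemma comp_case_nat: "(\<lambda>i. f (case_nat a g i)) = case_nat (f a) (\<lambda>i. f (g i))"
  by (auto split: nat.split)

lemma sat_sub:
  "sat M \<nu> \<xi> (sub \<sigma> \<rho> \<phi>) \<longleftrightarrow> sat M (\<lambda>i. teval \<nu> (\<sigma> i)) (\<lambda>X. \<xi> (\<rho> X)) \<phi>"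
  by (induction \<phi> arbitrary: \<nu> \<xi> \<sigma> \<rho>) (simp_all add: teval_tsub comp_case_nat cong del: nat.case_cong_weak)

lemma sat_inst: "sat M \<nu> \<xi> (inst t \<phi>) \<longleftrightarrow> sat M (case_nat (teval \<nu> t) \<nu>) \<xi> \<phi>"
  by (simp add: inst_def sat_sub comp_case_nat cong del: nat.case_cong_weak)

lemma sat_instS: "sat M \<nu> \<xi> (instS Y \<phi>) \<longleftrightarrow> sat M \<nu> (case_nat (\<xi> Y) \<xi>) \<phi>"
  by (simp add: instS_def sat_sub comp_case_nat cong del: nat.case_cong_weak)

lemma sat_wk: "sat M (case_nat n \<nu>) \<xi> (wk \<phi>) \<longleftrightarrow> sat M \<nu> \<xi> \<phi>"
  by (simp add: wk_def sat_sub)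

lemma sat_wkS: "sat M \<nu> (case_nat X \<xi>) (wkS \<phi>) \<longleftrightarrow> sat M \<nu> \<xi> \<phi>"
  by (simp add: wkS_def sat_sub)

text \<open>Assignments of finite support suffice for soundness, and there are only countably many of
  them.\<close>

definition env :: "nat list \<Rightarrow> nat \<Rightarrow> nat" where
  "env x i = (if i < length x then x ! i else 0)"

lemma case_nat_env: "case_nat n (env x) = env (n # x)"
  by (auto simp: env_def fun_eq_iff split: nat.split)

definition valid :: "nat set set \<Rightarrow> fm \<Rightarrow> bool" where
  "valid M \<phi> \<longleftrightarrow> (\<forall>x \<xi>. range \<xi> \<subseteq> M \<longrightarrow> sat M (env x) \<xi> \<phi>)"

lemma range_case_nat: "range \<xi> \<subseteq> M \<Longrightarrow> X \<in> M \<Longrightarrow> range (case_nat X \<xi>) \<subseteq> M"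
  by (auto simp: image_subset_iff split: nat.split)

theorem soundness:
  assumes "T \<turnstile> \<phi>" and "\<And>\<psi>. \<psi> \<in> T \<Longrightarrow> valid M \<psi>"
  shows "valid M \<phi>"
  using assms(1)
proof induction
  case (ax \<phi>)
  then show ?case by (rule assms(2))
next
  case (genS \<phi>)
  then show ?case by (simp add: valid_def range_case_nat)
next
  case (gen \<phi>)
  then show ?case by (simp add: valid_def case_nat_env)
next
  case (allS_inst \<phi> Y)
  then show ?case by (simp add: valid_def sat_instS image_subset_iff)
qed (simp_all add: valid_def sat_inst sat_wk sat_wkS flip: case_nat_env)

lemma valid_basic:
  assumes "\<phi> \<in> basic_axioms"
  shows "valid M \<phi>"
  using assms by (auto simp: basic_axioms_def Let_def valid_def)

text \<open>The number sort ranges over the true natural numbers, so induction holds for formulas of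
  any complexity.\<close>

lemma valid_ind: "valid M (ind_axiom \<phi>)"
proof -
  have "sat M (case_nat n \<nu>) \<xi> \<phi>"
    if "sat M (case_nat 0 \<nu>) \<xi> \<phi>"
      and "\<And>n. sat M (case_nat n \<nu>) \<xi> \<phi> \<Longrightarrow> sat M (case_nat (Suc n) \<nu>) \<xi> \<phi>" for n \<nu> \<xi>
    by (induction n) (rule that; assumption?)+
  then show ?thesis
    by (simp add: valid_def ind_axiom_def sat_inst sat_sub comp_case_nat
        cong del: nat.case_cong_weak)
qed


section \<open>A class of sets with a universal enumeration\<close>

definition slen :: "nat \<Rightarrow> nat \<Rightarrow> bool" where
  "slen \<tau> n \<longleftrightarrow> 2 ^ n \<le> \<tau> \<and> \<tau> < 2 ^ Suc n"

definition sprefix :: "nat \<Rightarrow> nat \<Rightarrow> bool" where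
  "sprefix \<tau> \<sigma> \<longleftrightarrow> (\<exists>m n. slen \<tau> m \<and> slen \<sigma> n \<and> m \<le> n \<and> (\<forall>i<m. bit \<tau> i \<longleftrightarrow> bit \<sigma> i))"

definition pair_code :: "nat \<Rightarrow> nat \<Rightarrow> nat" where
  "pair_code k n = (k + n) * (k + n) + k"

definition cov :: "nat set \<Rightarrow> nat \<Rightarrow> nat \<Rightarrow> bool" where
  "cov U t \<sigma> \<longleftrightarrow> (\<exists>\<tau>\<in>U. (\<exists>n. slen \<tau> n \<and> n < t) \<and> sprefix \<tau> \<sigma>)"

definition cnt :: "nat set \<Rightarrow> nat \<Rightarrow> nat" where
  "cnt U t = card {i. i < 2 ^ t \<and> cov U t (2 ^ t + i)}"

definition comp_set :: "nat set \<Rightarrow> nat \<Rightarrow> nat set" where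
  "comp_set G k = {\<tau>. pair_code k \<tau> \<in> G}"

definition inter_set :: "nat set \<Rightarrow> nat \<Rightarrow> nat set" where
  "inter_set G n = {\<sigma>. \<forall>k\<le>n. \<exists>\<tau>\<in>comp_set G k. sprefix \<tau> \<sigma>}"

section \<open>Formulas and their evaluation in stages\<close>

instance tm :: countable by countable_datatype

text \<open>\<open>Refute\<close> carries the number of a formula instead of the formula, because
  \<open>sf\<close> is built on top of \<open>fnm\<close>; countability of \<open>sf\<close>
  provides the decoding.\<close>

datatype fnm = EqN tm tm | LtN tm tm | Cover nat | Cylinders | Refute nat
text \<open>\<open>Push\<close> supplies the bound that \<open>BAll\<close> reads,
  \<open>Only\<close> isolates the argument for the code of a set, and \<open>Append\<close> fixes
  the parameters of a comprehension instance.\<close>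

datatype rnm = Push tm | Only tm | Append "nat list"
datatype sf = Fn bool fnm | Sub rnm sf | Conj sf sf | Disj sf sf | Exi sf | BAll sf

instance fnm :: countable by countable_datatype
instance rnm :: countable by countable_datatype
instance sf :: countable by countable_datatype

text \<open>For a table \<open>T\<close>, \<open>T s q y\<close> is meant to say that the formula
  \<open>q\<close> has been verified for the arguments \<open>y\<close> by stage
  \<open>s\<close>.\<close>

type_synonym table = "nat \<Rightarrow> sf \<Rightarrow> nat list \<Rightarrow> bool"

definition pos_part :: "nat \<Rightarrow> sf" where
  "pos_part e = fst (from_nat e :: sf \<times> sf)"

definition neg_part :: "nat \<Rightarrow> sf" where
  "neg_part e = snd (from_nat e :: sf \<times> sf)"

text \<open>The number \<open>e\<close> stands for a pair of formulas that may define a set and its complement. Taking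
  the first stage at which \<open>e + k + 1\<close> values are decided makes the string of these values unique
  even for pairs that do not define a set, which bounds the measure of the union by \<open>2\<^sup>-\<^sup>k\<close>.\<close>

definition decided :: "table \<Rightarrow> nat \<Rightarrow> nat \<Rightarrow> nat \<Rightarrow> bool" where
  "decided T l e s \<longleftrightarrow>
    (\<forall>i<l. T s (pos_part e) [i] \<or> T s (neg_part e) [i])"

definition cover_str :: "table \<Rightarrow> nat \<Rightarrow> nat \<Rightarrow> bool" where
  "cover_str T k \<tau> \<longleftrightarrow>
    (\<exists>n. slen \<tau> n \<and> (\<exists>e s. s \<le> n \<and> e + k + 1 \<le> n \<and> decided T (e + k + 1) e s
      \<and> (\<forall>s'<s. \<not> decided T (e + k + 1) e s')
      \<and> (\<forall>i<e + k + 1. bit \<tau> i \<longleftrightarrow> T s (pos_part e) [i])))"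

definition lead :: "nat \<Rightarrow> nat \<Rightarrow> bool" where
  "lead e \<tau> \<longleftrightarrow> (\<forall>i<3 * e + 1. bit \<tau> i \<longleftrightarrow> i = 3 * e)"

text \<open>The length \<open>l\<close> doubles as a stage, which keeps membership decidable. In
  component \<open>k\<close> the cylinder of \<open>e\<close> is eventually present in full iff
  formula \<open>e\<close> holds of \<open>[e, k]\<close>, so it survives in the intersection iff
  this is so for every \<open>k\<close>.\<close>

definition cylinder_str :: "table \<Rightarrow> nat \<Rightarrow> bool" where
  "cylinder_str T x \<longleftrightarrow>
    (\<exists>k \<tau> l e. x = pair_code k \<tau> \<and> slen \<tau> l \<and> 3 * e + 1 \<le> l \<and> lead e \<tau> \<and> T l (from_nat e) [e, k])"

text \<open>For finite \<open>F\<close> this is the measure of the union of the cylinders with index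
  in \<open>F\<close>, which are disjoint.\<close>

definition weight :: "nat set \<Rightarrow> real" where
  "weight F = (\<Sum>i\<in>F. 1 / 2 ^ (3 * i + 1))"

text \<open>The number \<open>v\<close> codes a potential \<open>\<Sigma>\<^sub>2\<close> witness for the \<open>\<Pi>\<^sub>2\<close> property of \<open>e\<close>: a set \<open>F\<close>
  containing all smaller members of the \<open>\<Pi>\<^sub>2\<close> set, which \<open>w\<close> certifies by counterexamples for
  the numbers outside of \<open>F\<close>, and an index \<open>n\<close> at which the measure of the \<open>F\<^sub>\<sigma>\<close> set coded
  by \<open>a\<close> is seen to exceed the weight of \<open>F\<close> by enough.\<close>

definition refuted :: "table \<Rightarrow> sf \<Rightarrow> nat \<Rightarrow> nat \<Rightarrow> nat \<Rightarrow> nat \<Rightarrow> bool" where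
  "refuted T a s t e v \<longleftrightarrow>
    (case from_nat v of (F, n, w) \<Rightarrow>
      \<not> set F \<subseteq> {..<e}
      \<or> (\<exists>i<e. i \<notin> set F \<and> T s (from_nat i) [i, env w i])
      \<or> real (cnt (inter_set {x. T s a [x]} n) t) / 2 ^ t > 1 - (weight (set F) + 1 / 2 ^ (3 * e + 2)))"

primrec fn_interp :: "fnm \<Rightarrow> table \<Rightarrow> nat list \<Rightarrow> bool" where
  "fn_interp (EqN t u) T x \<longleftrightarrow> teval (env x) t = teval (env x) u"
| "fn_interp (LtN t u) T x \<longleftrightarrow> teval (env x) t < teval (env x) u"
| "fn_interp (Cover k) T x \<longleftrightarrow> cover_str T k (env x 0)"
| "fn_interp Cylinders T x \<longleftrightarrow> cylinder_str T (env x 0)"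
| "fn_interp (Refute a) T x \<longleftrightarrow>
    (\<exists>s<env x 0. refuted T (from_nat a) s (env x 1) (env x 2) (env x 3))"

primrec rn_interp :: "rnm \<Rightarrow> nat list \<Rightarrow> nat list" where
  "rn_interp (Push t) x = teval (env x) t # x"
| "rn_interp (Only t) x = [teval (env x) t]"
| "rn_interp (Append y) x = x @ y"

text \<open>Negation is confined to atoms, so that truth persists to later stages. The stage bounds
  the witnesses of \<open>Exi\<close> and the first argument of atoms. \<open>BAll\<close> finds its
  bound at the head of the list and overwrites it with the quantified value.\<close>

primrec ev :: "table \<Rightarrow> nat \<Rightarrow> sf \<Rightarrow> nat list \<Rightarrow> bool" where
  "ev T n (Fn b f) x \<longleftrightarrow> env x 0 < n \<and> (fn_interp f (\<lambda>s q y. s < env x 0 \<and> T s q y) x \<longleftrightarrow> b)"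
| "ev T n (Sub r p) x \<longleftrightarrow> ev T n p (rn_interp r x)"
| "ev T n (Conj p q) x \<longleftrightarrow> ev T n p x \<and> ev T n q x"
| "ev T n (Disj p q) x \<longleftrightarrow> ev T n p x \<or> ev T n q x"
| "ev T n (Exi p) x \<longleftrightarrow> (\<exists>y<n. ev T n p (y # x))"
| "ev T n (BAll p) x \<longleftrightarrow> (\<forall>y<env x 0. ev T n p (y # tl x))"

text \<open>The atomic formula \<open>Fn b f\<close> may consult the evaluation of all formulas at the
  stages below its first argument. Hence \<open>sem\<close> is universal for itself, without any
  arithmetization of syntax.\<close>

declare conj_cong [fundef_cong]

fun sems :: "nat \<Rightarrow> sf \<Rightarrow> nat list \<Rightarrow> bool" where
  "sems n p x \<longleftrightarrow> ev (\<lambda>s q y. s < n \<and> sems s q y) n p x"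

declare sems.simps [simp del]

definition sem :: "sf \<Rightarrow> nat list \<Rightarrow> bool" where
  "sem p x \<longleftrightarrow> (\<exists>n. sems n p x)"

lemma sems_Fn:
  "sems n (Fn b f) x \<longleftrightarrow>
    env x 0 < n \<and> (fn_interp f (\<lambda>s q y. s < env x 0 \<and> sems s q y) x \<longleftrightarrow> b)"
proof (cases "env x 0 < n")
  case True
  then have "(\<lambda>s q y. s < env x 0 \<and> s < n \<and> sems s q y) = (\<lambda>s q y. s < env x 0 \<and> sems s q y)"
    by (auto simp: fun_eq_iff)
  then show ?thesis
    by (simp add: sems.simps[of n])
qed (simp add: sems.simps[of n])

lemma sems_simps [simp]:
  "sems n (Sub r p) x \<longleftrightarrow> sems n p (rn_interp r x)"
  "sems n (Conj p q) x \<longleftrightarrow> sems n p x \<and> sems n q x"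
  "sems n (Disj p q) x \<longleftrightarrow> sems n p x \<or> sems n q x"
  "sems n (Exi p) x \<longleftrightarrow> (\<exists>y<n. sems n p (y # x))"
  "sems n (BAll p) x \<longleftrightarrow> (\<forall>y<env x 0. sems n p (y # tl x))"
  by (simp_all add: sems.simps[of n])

section \<open>Closure properties of truth at some stage\<close>

lemma sems_mono: "sems m p x \<Longrightarrow> m \<le> n \<Longrightarrow> sems n p x"
proof (induction p arbitrary: x)
  case (Exi p)
  then show ?case by simp (meson less_le_trans)
next
  case (Fn b f)
  then show ?case by (auto simp: sems_Fn)
qed auto

text \<open>An atom looks only at stages below its first argument, so its value is the same at all
  stages beyond that argument. Hence atoms are decidable, although \<open>sem\<close> as a whole is
  only enumerable.\<close>

lemma sem_Fn: "sem (Fn b f) x \<longleftrightarrow> (fn_interp f (\<lambda>s q y. s < env x 0 \<and> sems s q y) x \<longleftrightarrow> b)"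
  unfolding sem_def sems_Fn by auto

lemma sem_Sub: "sem (Sub r p) x \<longleftrightarrow> sem p (rn_interp r x)"
  by (simp add: sem_def)

lemma sem_Conj: "sem (Conj p q) x \<longleftrightarrow> sem p x \<and> sem q x"
proof
  assume "sem p x \<and> sem q x"
  then obtain m n where "sems m p x" "sems n q x" by (auto simp: sem_def)
  then have "sems (max m n) (Conj p q) x"
    by (auto intro: sems_mono)
  then show "sem (Conj p q) x" unfolding sem_def by blast
qed (auto simp: sem_def)

lemma sem_Disj: "sem (Disj p q) x \<longleftrightarrow> sem p x \<or> sem q x"
  by (auto simp: sem_def)

lemma sem_Exi: "sem (Exi p) x \<longleftrightarrow> (\<exists>y. sem p (y # x))"
proof
  assume "\<exists>y. sem p (y # x)"
  then obtain y n where "sems n p (y # x)" by (auto simp: sem_def)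
  then have "sems (max n (Suc y)) (Exi p) x"
    by (auto intro!: exI[of _ y] intro: sems_mono)
  then show "sem (Exi p) x" unfolding sem_def by blast
qed (auto simp: sem_def)

text \<open>Finitely many stages have a maximum. This bounding principle is behind every passage
  from pointwise stages to a common one.\<close>

lemma uniform_stage:
  fixes R :: "nat \<Rightarrow> nat \<Rightarrow> bool"
  assumes "\<And>y. y < b \<Longrightarrow> \<exists>s. R s y" and mono: "\<And>s s' y. R s y \<Longrightarrow> s \<le> s' \<Longrightarrow> R s' y"
  shows "\<exists>s. \<forall>y<b. R s y"
  using assms(1)
proof (induction b)
  case (Suc b)
  then obtain s where "\<forall>y<b. R s y" by auto
  moreover from Suc.prems obtain s' where "R s' b" by auto
  ultimately have "\<forall>y<Suc b. R (max s s') y"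
    by (auto simp: less_Suc_eq intro: mono)
  then show ?case by blast
qed simp

lemma sem_uniform_stage:
  assumes "\<And>y. y < (b::nat) \<Longrightarrow> sem (p y) (x y)"
  obtains s where "\<And>y. y < b \<Longrightarrow> sems s (p y) (x y)"
  using uniform_stage[of b "\<lambda>s y. sems s (p y) (x y)"] assms sems_mono unfolding sem_def by blast

lemma sem_BAll: "sem (BAll p) x \<longleftrightarrow> (\<forall>y<env x 0. sem p (y # tl x))"
proof
  assume "\<forall>y<env x 0. sem p (y # tl x)"
  then obtain n where "\<And>y. y < env x 0 \<Longrightarrow> sems n p (y # tl x)"
    using sem_uniform_stage[of "env x 0" "\<lambda>_. p" "\<lambda>y. y # tl x"] by blast
  then show "sem (BAll p) x" unfolding sem_def by (auto intro!: exI[of _ n])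
qed (auto simp: sem_def)

lemmas sem_simps = sem_Sub sem_Conj sem_Disj sem_Exi sem_BAll


section \<open>An \<open>\<omega>\<close>-model of the base system\<close>

definition Sig :: "(nat list \<Rightarrow> bool) \<Rightarrow> bool" where
  "Sig P \<longleftrightarrow> (\<exists>p. \<forall>x. sem p x \<longleftrightarrow> P x)"

definition Rec :: "nat set set" where
  "Rec = {X. \<exists>p q. \<forall>n. (sem p [n] \<longleftrightarrow> n \<in> X) \<and> (sem q [n] \<longleftrightarrow> n \<notin> X)}"

lemma SigI: "(\<And>x. sem p x \<longleftrightarrow> P x) \<Longrightarrow> Sig P"
  unfolding Sig_def by blast

lemma Sig_Disj: "Sig P \<Longrightarrow> Sig Q \<Longrightarrow> Sig (\<lambda>x. P x \<or> Q x)"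
  unfolding Sig_def by (metis sem_Disj)

lemma Sig_Conj: "Sig P \<Longrightarrow> Sig Q \<Longrightarrow> Sig (\<lambda>x. P x \<and> Q x)"
  unfolding Sig_def by (metis sem_Conj)

lemma Sig_Exi: "Sig P \<Longrightarrow> Sig (\<lambda>x. \<exists>y. P (y # x))"
  unfolding Sig_def by (metis sem_Exi)

lemma Sig_BAll:
  assumes "Sig P"
  shows "Sig (\<lambda>x. \<forall>y<teval (env x) t. P (y # x))"
proof -
  obtain p where p: "\<And>x. sem p x \<longleftrightarrow> P x" using assms by (auto simp: Sig_def)
  show ?thesis
    by (rule SigI[of "Sub (Push t) (BAll p)"]) (simp add: sem_simps p, simp add: env_def)
qed

lemma Rec_codes:
  assumes "X \<in> Rec"
  obtains p q where "\<And>n. sem p [n] \<longleftrightarrow> n \<in> X" "\<And>n. sem q [n] \<longleftrightarrow> n \<notin> X"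
  using assms unfolding Rec_def by blast

lemma RecI: "(\<And>n. sem p [n] \<longleftrightarrow> n \<in> X) \<Longrightarrow> (\<And>n. sem q [n] \<longleftrightarrow> n \<notin> X) \<Longrightarrow> X \<in> Rec"
  unfolding Rec_def by blast

text \<open>The formulas of \<open>sf\<close> are not closed under negation, so a formula and its
  negation go through the induction together; implication and the bounded quantifier draw on
  both.\<close>

lemma delta0_Sig:
  assumes "delta0 \<phi>" and \<xi>: "range \<xi> \<subseteq> Rec"
  shows "Sig (\<lambda>x. sat M (env x) \<xi> \<phi>) \<and> Sig (\<lambda>x. \<not> sat M (env x) \<xi> \<phi>)"
  using assms(1)
proof induction
  case 1
  show ?case
    using SigI[of "Fn True (LtN Zero Zero)"] SigI[of "Fn False (LtN Zero Zero)"] by (simp add: sem_Fn)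
next
  case (2 s t)
  show ?case
    using SigI[of "Fn True (EqN s t)"] SigI[of "Fn False (EqN s t)"] by (simp add: sem_Fn)
next
  case (3 s t)
  show ?case
    using SigI[of "Fn True (LtN s t)"] SigI[of "Fn False (LtN s t)"] by (simp add: sem_Fn)
next
  case (4 t X)
  obtain p q where "\<And>n. sem p [n] \<longleftrightarrow> n \<in> \<xi> X" "\<And>n. sem q [n] \<longleftrightarrow> n \<notin> \<xi> X"
    using \<xi> by (meson Rec_codes range_subsetD)
  then show ?case
    using SigI[of "Sub (Only t) p"] SigI[of "Sub (Only t) q"] by (simp add: sem_Sub)
next
  case (5 \<phi> \<psi>)
  then show ?case
    using Sig_Disj[of "\<lambda>x. \<not> sat M (env x) \<xi> \<phi>" "\<lambda>x. sat M (env x) \<xi> \<psi>"]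
    by (simp add: Sig_Conj)
next
  case (6 \<phi> t)
  have twk: "teval (case_nat y (env x)) (twk t) = teval (env x) t" for x y
    by (simp add: teval_tsub)
  have "Sig (\<lambda>x. env x 0 < teval (env x) (twk t))"
    by (rule SigI[of "Fn True (LtN (Var 0) (twk t))"]) (simp add: sem_Fn)
  then have "Sig (\<lambda>x. \<exists>y. y < teval (env x) t \<and> \<not> sat M (env (y # x)) \<xi> \<phi>)"
    using Sig_Exi[OF Sig_Conj[of "\<lambda>x. env x 0 < teval (env x) (twk t)" "\<lambda>x. \<not> sat M (env x) \<xi> \<phi>"]] 6
    by (simp add: twk flip: case_nat_env)
  moreover have "Sig (\<lambda>x. \<forall>y<teval (env x) t. sat M (env (y # x)) \<xi> \<phi>)"
    using Sig_BAll 6 by blast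
  ultimately show ?case
    by (simp add: twk flip: case_nat_env)
qed

lemma Sig_append: "Sig P \<Longrightarrow> Sig (\<lambda>x. P (x @ y))"
  unfolding Sig_def by (metis sem_Sub rn_interp.simps(3))

text \<open>The existential formulas equivalent to \<phi> and to the negation of \<psi> form a code
  of the required set. Number parameters enter through \<open>Append\<close>, for which their list
  must be finite; set parameters have given way to their codes in \<open>delta0_Sig\<close>.\<close>

lemma valid_comp:
  assumes "sigma1 \<phi>" "pi1 \<psi>"
  shows "valid Rec (comp_axiom \<phi> \<psi>)"
proof -
  obtain \<theta> \<theta>' where \<theta>: "delta0 \<theta>" "\<phi> = Ex \<theta>" and \<theta>': "delta0 \<theta>'" "\<psi> = All \<theta>'"
    using assms by (auto simp: sigma1_def pi1_def)
  have "{n. sat Rec (env (n # x)) \<xi> \<phi>} \<in> Rec"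
    if \<xi>: "range \<xi> \<subseteq> Rec" and eq: "\<And>n. sat Rec (env (n # x)) \<xi> \<phi> \<longleftrightarrow> sat Rec (env (n # x)) \<xi> \<psi>" for x \<xi>
  proof -
    have "Sig (\<lambda>y. sat Rec (env (y @ x)) \<xi> \<phi>)"
      using Sig_append[OF Sig_Exi, of "\<lambda>x. sat Rec (env x) \<xi> \<theta>"] delta0_Sig[OF \<theta>(1) \<xi>]
      by (simp add: \<theta> case_nat_env)
    moreover have "Sig (\<lambda>y. \<not> sat Rec (env (y @ x)) \<xi> \<psi>)"
      using Sig_append[OF Sig_Exi, of "\<lambda>x. \<not> sat Rec (env x) \<xi> \<theta>'"] delta0_Sig[OF \<theta>'(1) \<xi>]
      by (simp add: \<theta>' case_nat_env)
    ultimately obtain p q where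
      "\<And>y. sem p y \<longleftrightarrow> sat Rec (env (y @ x)) \<xi> \<phi>" "\<And>y. sem q y \<longleftrightarrow> \<not> sat Rec (env (y @ x)) \<xi> \<psi>"
      unfolding Sig_def by blast
    then show ?thesis
      by (intro RecI[of p _ q]) (simp_all add: eq)
  qed
  then have "\<exists>X\<in>Rec. \<forall>n. n \<in> X \<longleftrightarrow> sat Rec (env (n # x)) \<xi> \<phi>"
    if "range \<xi> \<subseteq> Rec" "\<And>n. sat Rec (env (n # x)) \<xi> \<phi> \<longleftrightarrow> sat Rec (env (n # x)) \<xi> \<psi>" for x \<xi>
    using that by (metis (mono_tags, lifting) mem_Collect_eq)
  moreover have "env (n # x) 0 = n" for n x
    by (simp add: env_def)
  ultimately show ?thesis
    unfolding valid_def comp_axiom_def by (simp add: sat_wkS case_nat_env flip: iff_conv_conj_imp)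
qed

lemma valid_RCA0: "\<phi> \<in> RCA0 \<Longrightarrow> valid Rec \<phi>"
  unfolding RCA0_def using valid_basic valid_ind valid_comp by blast

lemma Rec_empty: "{} \<in> Rec"
  by (rule RecI[of "Fn True (LtN Zero Zero)" _ "Fn False (LtN Zero Zero)"]) (simp_all add: sem_Fn)

theorem RCA0_sound:
  assumes "RCA0 \<turnstile> \<phi>"
  shows "sat Rec (\<lambda>_. 0) (\<lambda>_. {}) \<phi>"
proof -
  have "env [] = (\<lambda>_. 0)" by (simp add: env_def fun_eq_iff)
  then show ?thesis
    using soundness[OF assms valid_RCA0] Rec_empty unfolding valid_def
    by (metis image_subsetI)
qed


section \<open>Evaluation of formulas with named variables\<close>

abbreviation pushes :: "nat list \<Rightarrow> (nat \<Rightarrow> nat) \<Rightarrow> nat \<Rightarrow> nat" where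
  "pushes us \<nu> \<equiv> foldr case_nat us \<nu>"

definition nev :: "(nat \<Rightarrow> nat) \<Rightarrow> nat \<Rightarrow> ntm \<Rightarrow> nat" where
  "nev \<nu> d s = teval \<nu> (s d)"

definition nvar :: "nat \<Rightarrow> ntm" where
  "nvar d = (\<lambda>d'. Var (d' - Suc d))"

definition svar :: "nat \<Rightarrow> nset" where
  "svar e = (\<lambda>e'. e' - Suc e)"

text \<open>The terms that arise from the binders keep their value under further binders. An arbitrary
  function of the depth need not, whence the predicate \<open>gd\<close>.\<close>

definition gd :: "ntm \<Rightarrow> nat \<Rightarrow> (nat \<Rightarrow> nat) \<Rightarrow> bool" where
  "gd s d \<nu> \<longleftrightarrow> (\<forall>us. nev (pushes us \<nu>) (d + length us) s = nev \<nu> d s)"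

lemma pushes_length: "pushes us \<nu> (length us + i) = \<nu> i"
  by (induction us) auto

lemma gd_var: "gd (nvar d) (Suc d) (case_nat n \<nu>)"
  using pushes_length[of _ "case_nat n \<nu>" 0] by (simp add: gd_def nvar_def nev_def)

lemma gd_push: "gd s d \<nu> \<Longrightarrow> gd s (Suc d) (case_nat n \<nu>)"
proof -
  assume *: "gd s d \<nu>"
  have "nev (pushes us (case_nat n \<nu>)) (Suc d + length us) s = nev \<nu> d s" for us
    using *[unfolded gd_def, rule_format, of "us @ [n]"] by simp
  from this this[of "[]"] show ?thesis
    unfolding gd_def by simp
qed

lemma gd_pushes: "gd s d \<nu> \<Longrightarrow> gd s (d + length us) (pushes us \<nu>)"
  by (induction us) (simp_all add: gd_push)

lemma nev_push: "gd s d \<nu> \<Longrightarrow> nev (case_nat n \<nu>) (Suc d) s = nev \<nu> d s"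
  unfolding gd_def by (drule spec[of _ "[n]"]) simp

lemma nev_simps [simp]:
  "nev (case_nat n \<nu>) (Suc d) (nvar d) = n"
  "nev \<nu> d \<^bold>0 = 0"
  "nev \<nu> d \<^bold>1 = 1"
  "nev \<nu> d (s \<^bold>+ t) = nev \<nu> d s + nev \<nu> d t"
  "nev \<nu> d (s \<^bold>* t) = nev \<nu> d s * nev \<nu> d t"
  by (simp_all add: nev_def nvar_def n0_def n1_def nadd_def nmul_def)

lemma gd_simps [simp]:
  "gd \<^bold>0 d \<nu>"
  "gd \<^bold>1 d \<nu>"
  "gd s d \<nu> \<Longrightarrow> gd t d \<nu> \<Longrightarrow> gd (s \<^bold>+ t) d \<nu>"
  "gd s d \<nu> \<Longrightarrow> gd t d \<nu> \<Longrightarrow> gd (s \<^bold>* t) d \<nu>"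
  by (simp_all add: gd_def)

declare gd_var [simp] gd_push [simp] nev_push [simp]

lemma sat_nfm [simp]:
  "\<not> sat M \<nu> \<xi> (\<^bold>\<bottom> d e)"
  "sat M \<nu> \<xi> ((s \<^bold>= t) d e) \<longleftrightarrow> nev \<nu> d s = nev \<nu> d t"
  "sat M \<nu> \<xi> ((s \<^bold>< t) d e) \<longleftrightarrow> nev \<nu> d s < nev \<nu> d t"
  "sat M \<nu> \<xi> ((s \<^bold>\<le> t) d e) \<longleftrightarrow> nev \<nu> d s \<le> nev \<nu> d t"
  "sat M \<nu> \<xi> ((s \<^bold>\<in> X) d e) \<longleftrightarrow> nev \<nu> d s \<in> \<xi> (X e)"
  "sat M \<nu> \<xi> ((\<phi> \<^bold>\<longrightarrow> \<psi>) d e) \<longleftrightarrow> (sat M \<nu> \<xi> (\<phi> d e) \<longrightarrow> sat M \<nu> \<xi> (\<psi> d e))"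
  "sat M \<nu> \<xi> ((\<^bold>\<not> \<phi>) d e) \<longleftrightarrow> \<not> sat M \<nu> \<xi> (\<phi> d e)"
  "sat M \<nu> \<xi> ((\<phi> \<^bold>\<and> \<psi>) d e) \<longleftrightarrow> sat M \<nu> \<xi> (\<phi> d e) \<and> sat M \<nu> \<xi> (\<psi> d e)"
  "sat M \<nu> \<xi> ((\<phi> \<^bold>\<longleftrightarrow> \<psi>) d e) \<longleftrightarrow> (sat M \<nu> \<xi> (\<phi> d e) \<longleftrightarrow> sat M \<nu> \<xi> (\<psi> d e))"
  "sat M \<nu> \<xi> (nall A d e) \<longleftrightarrow> (\<forall>n. sat M (case_nat n \<nu>) \<xi> (A (nvar d) (Suc d) e))"
  "sat M \<nu> \<xi> (nex A d e) \<longleftrightarrow> (\<exists>n. sat M (case_nat n \<nu>) \<xi> (A (nvar d) (Suc d) e))"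
  "sat M \<nu> \<xi> (nallS B d e) \<longleftrightarrow> (\<forall>X\<in>M. sat M \<nu> (case_nat X \<xi>) (B (svar e) d (Suc e)))"
  "sat M \<nu> \<xi> (nexS B d e) \<longleftrightarrow> (\<exists>X\<in>M. sat M \<nu> (case_nat X \<xi>) (B (svar e) d (Suc e)))"
  by (auto simp: nfls_def neq_def nlt_def nle_def nmem_def nimp_def nneg_def nconj_def niff_def
      nall_def nex_def nallS_def nexS_def nev_def nvar_def svar_def nadd_def n1_def)


subsection \<open>Finite sequences and strings\<close>

definition bet :: "nat \<Rightarrow> nat \<Rightarrow> nat \<Rightarrow> nat" where
  "bet c d i = c mod (1 + (i + 1) * d)"

lemma coprime_if_no_common_prime:
  fixes a b :: nat
  assumes "\<And>p. prime p \<Longrightarrow> p dvd a \<Longrightarrow> p dvd b \<Longrightarrow> False"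
  shows "coprime a b"
proof (rule ccontr)
  assume "\<not> coprime a b"
  then have "gcd a b \<noteq> 1" by (simp add: coprime_iff_gcd_eq_1)
  then obtain p where "prime p" "p dvd gcd a b" using prime_factor_nat by blast
  with assms show False by (meson gcd_nat.bounded_iff)
qed

text \<open>A common prime of the two moduli divides their difference, which is \<open>j - i\<close>
  times the factorial. As \<open>j - i\<close> divides the factorial, so does the prime, which then
  divides 1.\<close>

lemma coprime_beta_moduli:
  assumes "i < j" "j \<le> n"
  shows "coprime (1 + (i + 1) * fact n) (1 + (j + 1) * fact n :: nat)"
proof (rule coprime_if_no_common_prime)
  fix p :: nat
  assume p: "prime p" "p dvd 1 + (i + 1) * fact n" "p dvd 1 + (j + 1) * fact n"
  have "1 + (i + k + 1) * F = (1 + (i + 1) * F) + k * F" for k F :: nat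
    by (simp add: algebra_simps)
  from this[of "j - i" "fact n"] have "p dvd (1 + (i + 1) * fact n) + (j - i) * fact n"
    using assms(1) p(3) by (simp only: le_add_diff_inverse less_imp_le)
  then have "p dvd (j - i) * fact n"
    using p(2) dvd_add_right_iff by blast
  then have "p dvd (j - i) \<or> p dvd fact n"
    using p(1) by (rule prime_dvd_multD[rotated])
  moreover have "j - i dvd fact n"
    using assms by (intro dvd_fact) auto
  ultimately have "p dvd fact n"
    using dvd_trans by blast
  then have "p dvd (i + 1) * fact n"
    by (rule dvd_mult)
  then have "p dvd 1"
    using p(2) dvd_add_left_iff by blast
  then show False
    using p(1) by auto
qed

lemma bet_exists: "\<exists>c d. \<forall>i\<le>n. bet c d i = f i"
proof -
  \<comment> \<open>\<open>N\<close> is at least \<open>n\<close>, for coprimality, and at least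
    every value, so that each value is below its modulus and equals the remainder.\<close>
  define N where "N = n + Max (f ` {..n})"
  define m :: "nat \<Rightarrow> nat" where "m i = 1 + (i + 1) * fact N" for i
  have "\<exists>c. \<forall>i\<in>{..n}. [c = f i] (mod m i)"
  proof (rule chinese_remainder_nat)
    show "\<forall>i\<in>{..n}. \<forall>j\<in>{..n}. i \<noteq> j \<longrightarrow> coprime (m i) (m j)"
    proof (intro ballI impI)
      fix i j assume "i \<in> {..n}" "j \<in> {..n}" "i \<noteq> j"
      then show "coprime (m i) (m j)"
        using coprime_beta_moduli[of i j N] coprime_beta_moduli[of j i N] unfolding m_def N_def
        by (metis atMost_iff coprime_commute nat_neq_iff trans_le_add1)
    qed
  qed simp
  then obtain c where c: "\<And>i. i \<le> n \<Longrightarrow> [c = f i] (mod m i)" by auto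
  have "bet c (fact N) i = f i" if "i \<le> n" for i
  proof -
    have "f i \<le> Max (f ` {..n})" using that by simp
    also have "\<dots> \<le> fact N" unfolding N_def by (metis fact_ge_self le_add2 le_trans)
    also have "\<dots> < m i" unfolding m_def by simp
    finally show ?thesis
      using c[OF that] by (simp add: bet_def m_def cong_def)
  qed
  then show ?thesis by blast
qed

lemma sat_beta [simp]:
  assumes "gd c d \<nu>" "gd b d \<nu>" "gd i d \<nu>" "gd v d \<nu>"
  shows "sat M \<nu> \<xi> (beta c b i v d e) \<longleftrightarrow> bet (nev \<nu> d c) (nev \<nu> d b) (nev \<nu> d i) = nev \<nu> d v"
proof -
  have "(\<exists>k. x = k * m + y \<and> y < m) \<longleftrightarrow> x mod m = y" if "m > 0" for x y m :: nat
    using that by (metis div_mod_decomp mod_less mod_less_divisor mod_mult_self3)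
  from this[of "1 + (nev \<nu> d i + 1) * nev \<nu> d b"] show ?thesis
    using assms by (simp add: beta_def bet_def)
qed

lemma sat_pow2 [simp]:
  assumes "gd k d \<nu>" "gd p d \<nu>"
  shows "sat M \<nu> \<xi> (pow2 k p d e) \<longleftrightarrow> nev \<nu> d p = 2 ^ nev \<nu> d k"
proof
  assume "nev \<nu> d p = 2 ^ nev \<nu> d k"
  moreover obtain c b where cb: "\<forall>i\<le>nev \<nu> d k. bet c b i = 2 ^ i"
    using bet_exists by blast
  ultimately have "bet c b 0 = 1 \<and> (\<forall>i<nev \<nu> d k. bet c b (i + 1) = bet c b i + bet c b i)
      \<and> bet c b (nev \<nu> d k) = nev \<nu> d p"
    by simp
  then show "sat M \<nu> \<xi> (pow2 k p d e)"
    using assms unfolding pow2_def by simp blast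
next
  assume "sat M \<nu> \<xi> (pow2 k p d e)"
  then obtain c b where cb: "bet c b 0 = 1" "bet c b (nev \<nu> d k) = nev \<nu> d p"
    and step: "\<And>i. i < nev \<nu> d k \<Longrightarrow> bet c b (Suc i) = bet c b i + bet c b i"
    using assms by (auto simp: pow2_def)
  have "i \<le> nev \<nu> d k \<Longrightarrow> bet c b i = 2 ^ i" for i
    by (induction i) (simp_all add: cb step)
  with cb show "nev \<nu> d p = 2 ^ nev \<nu> d k" by simp
qed

lemma sat_len [simp]:
  assumes "gd \<tau> d \<nu>" "gd n d \<nu>"
  shows "sat M \<nu> \<xi> (len \<tau> n d e) \<longleftrightarrow> slen (nev \<nu> d \<tau>) (nev \<nu> d n)"
  using assms by (simp add: len_def slen_def mult_2)

lemma sat_digit [simp]: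
  assumes "gd \<tau> d \<nu>" "gd i d \<nu>"
  shows "sat M \<nu> \<xi> (digit \<tau> i d e) \<longleftrightarrow> bit (nev \<nu> d \<tau>) (nev \<nu> d i)"
proof -
  have "(\<exists>h r. x = h * (p + p) + p + r \<and> r < p) \<longleftrightarrow> odd (x div p)" if "p > 0" for x p :: nat
  proof
    assume "odd (x div p)"
    then obtain q where "x div p = 2 * q + 1" by (rule oddE)
    then have "x = (2 * q + 1) * p + x mod p"
      using div_mult_mod_eq[of x p] by simp
    then have "x = q * (p + p) + p + x mod p"
      by (simp add: algebra_simps)
    then show "\<exists>h r. x = h * (p + p) + p + r \<and> r < p"
      using that mod_less_divisor by blast
  next
    assume "\<exists>h r. x = h * (p + p) + p + r \<and> r < p"
    then obtain h r where hr: "x = h * (p + p) + p + r" "r < p" by blast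
    then have "x = r + (2 * h + 1) * p" by (simp add: algebra_simps)
    then have "x div p = r div p + (2 * h + 1)"
      using that by (metis div_mult_self1 less_not_refl3 add.commute)
    then have "x div p = 2 * h + 1" using hr(2) by simp
    then show "odd (x div p)" by simp
  qed
  from this[of "2 ^ nev \<nu> d i"] show ?thesis
    using assms by (simp add: digit_def bit_iff_odd)
qed

lemma sat_prefix [simp]:
  assumes "gd \<tau> d \<nu>" "gd \<sigma> d \<nu>"
  shows "sat M \<nu> \<xi> (prefix \<tau> \<sigma> d e) \<longleftrightarrow> sprefix (nev \<nu> d \<tau>) (nev \<nu> d \<sigma>)"
  using assms by (simp add: prefix_def sprefix_def)

definition sinit :: "nat \<Rightarrow> nat set \<Rightarrow> bool" where
  "sinit \<tau> X \<longleftrightarrow> (\<exists>n. slen \<tau> n \<and> (\<forall>i<n. bit \<tau> i \<longleftrightarrow> i \<in> X))"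

lemma sat_initseg [simp]:
  assumes "gd \<tau> d \<nu>"
  shows "sat M \<nu> \<xi> (initseg \<tau> X d e) \<longleftrightarrow> sinit (nev \<nu> d \<tau>) (\<xi> (X e))"
  using assms by (simp add: initseg_def sinit_def)


subsection \<open>Rationals\<close>

fun qv :: "(nat \<Rightarrow> nat) \<Rightarrow> nat \<Rightarrow> nrat \<Rightarrow> real" where
  "qv \<nu> d (a, b, c) = (real (nev \<nu> d a) - real (nev \<nu> d b)) / (real (nev \<nu> d c) + 1)"

fun gq :: "nrat \<Rightarrow> nat \<Rightarrow> (nat \<Rightarrow> nat) \<Rightarrow> bool" where
  "gq (a, b, c) d \<nu> \<longleftrightarrow> gd a d \<nu> \<and> gd b d \<nu> \<and> gd c d \<nu>"

lemma gq_push [simp]: "gq q d \<nu> \<Longrightarrow> gq q (Suc d) (case_nat n \<nu>)"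
  by (cases q) simp

lemma qv_push [simp]: "gq q d \<nu> \<Longrightarrow> qv (case_nat n \<nu>) (Suc d) q = qv \<nu> d q"
  by (cases q) simp

lemma gq_one_minus [simp]: "gq q d \<nu> \<Longrightarrow> gq (one_minus q) d \<nu>"
  by (cases q) simp

lemma qv_one_minus [simp]: "qv \<nu> d (one_minus q) = 1 - qv \<nu> d q"
  by (cases q) (simp add: field_simps)

lemma gq_qminus [simp]: "gq q d \<nu> \<Longrightarrow> gq r d \<nu> \<Longrightarrow> gq (qminus q r) d \<nu>"
  by (cases q; cases r) simp

lemma qv_qminus [simp]: "qv \<nu> d (qminus q r) = qv \<nu> d q - qv \<nu> d r"
proof (cases q; cases r)
  fix a b c a' b' c'
  assume *: "q = (a, b, c)" "r = (a', b', c')"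
  have "real (nev \<nu> d c * nev \<nu> d c' + nev \<nu> d c + nev \<nu> d c') + 1
    = (real (nev \<nu> d c) + 1) * (real (nev \<nu> d c') + 1)"
    by (simp add: algebra_simps)
  then show ?thesis
    unfolding * by (simp add: field_simps)
qed

lemma sat_qless [simp]:
  "sat M \<nu> \<xi> (qless q r d e) \<longleftrightarrow> qv \<nu> d q < qv \<nu> d r"
proof (cases q; cases r)
  fix a b c a' b' c'
  assume *: "q = (a, b, c)" "r = (a', b', c')"
  have "x * (w + 1) + v * (z + 1) < u * (z + 1) + y * (w + 1) \<longleftrightarrow>
    (real x - real y) / (real z + 1) < (real u - real v) / (real w + 1)" for x y z u v w :: nat
  proof -
    have "x * (w + 1) + v * (z + 1) < u * (z + 1) + y * (w + 1) \<longleftrightarrow>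
      real (x * (w + 1) + v * (z + 1)) < real (u * (z + 1) + y * (w + 1))"
      by (simp only: of_nat_less_iff)
    then show ?thesis by (simp add: field_simps)
  qed
  from this[of "nev \<nu> d a" "nev \<nu> d c'" "nev \<nu> d b'" "nev \<nu> d c" "nev \<nu> d a'" "nev \<nu> d b"]
  show ?thesis unfolding * by simp
qed

lemma sat_frac_le [simp]:
  assumes "nev \<nu> d p > 0"
  shows "sat M \<nu> \<xi> (frac_le m p q d e) \<longleftrightarrow> real (nev \<nu> d m) / real (nev \<nu> d p) \<le> qv \<nu> d q"
proof (cases q)
  case (fields a b c)
  have "m * (z + 1) + y * p \<le> x * p \<longleftrightarrow> real m / real p \<le> (real x - real y) / (real z + 1)"
    if "p > 0" for x y z m p :: nat
  proof -
    have "m * (z + 1) + y * p \<le> x * p \<longleftrightarrow> real (m * (z + 1) + y * p) \<le> real (x * p)"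
      by (simp only: of_nat_le_iff)
    then show ?thesis using that by (simp add: field_simps)
  qed
  from this[OF assms, of "nev \<nu> d m" "nev \<nu> d c" "nev \<nu> d b" "nev \<nu> d a"]
  show ?thesis by (simp add: fields)
qed

lemma sat_frac_gt [simp]:
  assumes "nev \<nu> d p > 0"
  shows "sat M \<nu> \<xi> (frac_gt m p q d e) \<longleftrightarrow> qv \<nu> d q < real (nev \<nu> d m) / real (nev \<nu> d p)"
proof -
  have "sat M \<nu> \<xi> (frac_gt m p q d e) \<longleftrightarrow> \<not> sat M \<nu> \<xi> (frac_le m p q d e)"
    by (cases q) auto
  with assms show ?thesis by (simp add: not_le)
qed

lemma nat_triple_Rats:
  "(\<forall>a b c. P ((real a - real b) / (real c + 1))) \<longleftrightarrow> (\<forall>q\<in>\<rat>. P q)"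
proof
  assume *: "\<forall>a b c. P ((real a - real b) / (real c + 1))"
  show "\<forall>q\<in>\<rat>. P q"
  proof
    fix q :: real assume "q \<in> \<rat>"
    then obtain i :: int and n :: nat where n: "n \<noteq> 0" "q = of_int i / of_nat n"
      by (metis Rats_eq_int_div_nat[THEN equalityD1, THEN subsetD, THEN CollectD])
    have "of_int i = real (nat i) - real (nat (- i))" by simp
    moreover have "real n = real (n - 1) + 1" using n by simp
    ultimately show "P q" using * n(2) by metis
  qed
qed simp

lemma sat_nallQ:
  assumes "\<And>a b c. sat M (case_nat c (case_nat b (case_nat a \<nu>))) \<xi>
      (A (nvar d, nvar (Suc d), nvar (Suc (Suc d))) (Suc (Suc (Suc d))) e)
    \<longleftrightarrow> P ((real a - real b) / (real c + 1))"
  shows "sat M \<nu> \<xi> (nallQ A d e) \<longleftrightarrow> (\<forall>q\<in>\<rat>. P q)"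
  by (simp add: nallQ_def assms nat_triple_Rats)


subsection \<open>Codes of open sets\<close>

definition cset :: "nat set set \<Rightarrow> (nat \<Rightarrow> nat set) \<Rightarrow> nat \<Rightarrow> (nat \<Rightarrow> nat) \<Rightarrow> nat \<Rightarrow> ncode \<Rightarrow> nat set" where
  "cset M \<xi> e \<nu> d U = {a. sat M (case_nat a \<nu>) \<xi> (U (nvar d) (Suc d) e)}"

text \<open>The counterpart of \<open>gd\<close> for codes\<close>

definition gc :: "nat set set \<Rightarrow> (nat \<Rightarrow> nat set) \<Rightarrow> nat \<Rightarrow> (nat \<Rightarrow> nat) \<Rightarrow> nat \<Rightarrow> ncode \<Rightarrow> bool" where
  "gc M \<xi> e \<nu> d U \<longleftrightarrow>
    (\<forall>us s. gd s (d + length us) (pushes us \<nu>) \<longrightarrow>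
      (sat M (pushes us \<nu>) \<xi> (U s (d + length us) e)
        \<longleftrightarrow> nev (pushes us \<nu>) (d + length us) s \<in> cset M \<xi> e \<nu> d U))"

lemma gcD:
  assumes "gc M \<xi> e \<nu> d U" "gd s d \<nu>"
  shows "sat M \<nu> \<xi> (U s d e) \<longleftrightarrow> nev \<nu> d s \<in> cset M \<xi> e \<nu> d U"
  using assms unfolding gc_def by (metis add.right_neutral foldr_Nil id_apply list.size(3))

lemma cset_push:
  assumes "gc M \<xi> e \<nu> d U"
  shows "cset M \<xi> e (case_nat n \<nu>) (Suc d) U = cset M \<xi> e \<nu> d U"
proof -
  have "sat M (case_nat a (case_nat n \<nu>)) \<xi> (U (nvar (Suc d)) (Suc (Suc d)) e)
    \<longleftrightarrow> a \<in> cset M \<xi> e \<nu> d U" for a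
    using assms[unfolded gc_def, rule_format, of "nvar (Suc d)" "[a, n]"] by simp
  then show ?thesis
    unfolding cset_def[of _ _ _ _ "Suc d"] by blast
qed

lemma gc_push:
  assumes "gc M \<xi> e \<nu> d U"
  shows "gc M \<xi> e (case_nat n \<nu>) (Suc d) U"
  unfolding gc_def
proof (intro allI impI)
  fix us s
  assume "gd s (Suc d + length us) (pushes us (case_nat n \<nu>))"
  then show "sat M (pushes us (case_nat n \<nu>)) \<xi> (U s (Suc d + length us) e) \<longleftrightarrow>
      nev (pushes us (case_nat n \<nu>)) (Suc d + length us) s \<in> cset M \<xi> e (case_nat n \<nu>) (Suc d) U"
    using assms[unfolded gc_def, rule_format, of s "us @ [n]"] cset_push[OF assms] by simp
qed

lemma mem_cset: "sat M (case_nat a \<nu>) \<xi> (U (nvar d) (Suc d) e) \<longleftrightarrow> a \<in> cset M \<xi> e \<nu> d U"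
  by (simp add: cset_def)

lemma sat_covered:
  assumes "gd t d \<nu>" "gd \<sigma> d \<nu>"
  shows "sat M \<nu> \<xi> (covered U t \<sigma> d e) \<longleftrightarrow> cov (cset M \<xi> e \<nu> d U) (nev \<nu> d t) (nev \<nu> d \<sigma>)"
  using assms by (auto simp: covered_def cov_def mem_cset[of M _ \<nu> \<xi> U])

text \<open>The partial counts obey a recursion with a unique solution, and
  \<open>bet_exists\<close> codes its initial part.\<close>

lemma sat_cover_count:
  assumes U: "gc M \<xi> e \<nu> d U" and gd: "gd t d \<nu>" "gd m d \<nu>" "gd p d \<nu>"
  shows "sat M \<nu> \<xi> (cover_count U t m p d e) \<longleftrightarrow>
    nev \<nu> d p = 2 ^ nev \<nu> d t \<and> nev \<nu> d m = cnt (cset M \<xi> e \<nu> d U) (nev \<nu> d t)"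
proof -
  define C where "C i \<longleftrightarrow> cov (cset M \<xi> e \<nu> d U) (nev \<nu> d t) (2 ^ nev \<nu> d t + i)" for i
  define count where "count i = card {j. j < i \<and> C j}" for i
  have count_Suc: "count (Suc i) = (if C i then count i + 1 else count i)" for i
  proof -
    have "{j. j < Suc i \<and> C j} = (if C i then insert i {j. j < i \<and> C j} else {j. j < i \<and> C j})"
      by (auto simp: less_Suc_eq)
    then show ?thesis by (simp add: count_def)
  qed
  have "(\<exists>c b. bet c b 0 = 0
      \<and> (\<forall>i<P. (C i \<longrightarrow> bet c b (Suc i) = Suc (bet c b i)) \<and> (\<not> C i \<longrightarrow> bet c b (Suc i) = bet c b i))
      \<and> bet c b P = x) \<longleftrightarrow> x = count P" for P x
  proof safe
    fix c b
    assume *: "bet c b 0 = 0" "\<forall>i<P. (C i \<longrightarrow> bet c b (Suc i) = Suc (bet c b i))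
      \<and> (\<not> C i \<longrightarrow> bet c b (Suc i) = bet c b i)"
    have "i \<le> P \<Longrightarrow> bet c b i = count i" for i
    proof (induction i)
      case (Suc i)
      then show ?case using *(2) by (simp add: count_Suc)
    qed (simp add: * count_def)
    then show "bet c b P = count P" by simp
  next
    obtain c b where cb: "\<forall>i\<le>P. bet c b i = count i" using bet_exists by blast
    have "bet c b 0 = 0" using cb by (simp add: count_def)
    moreover have "\<forall>i<P. (C i \<longrightarrow> bet c b (Suc i) = Suc (bet c b i))
      \<and> (\<not> C i \<longrightarrow> bet c b (Suc i) = bet c b i)"
      using cb by (simp add: count_Suc)
    ultimately show "\<exists>c b. bet c b 0 = 0
      \<and> (\<forall>i<P. (C i \<longrightarrow> bet c b (Suc i) = Suc (bet c b i)) \<and> (\<not> C i \<longrightarrow> bet c b (Suc i) = bet c b i))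
      \<and> bet c b P = count P"
      using cb by blast
  qed
  from this[of "2 ^ nev \<nu> d t", unfolded C_def] show ?thesis
    using gd U
    by (simp add: cover_count_def sat_covered gc_push cset_push cong: conj_cong)
      (simp add: count_def C_def cnt_def)
qed

section \<open>Measure inequalities as inequalities between real numbers\<close>

definition ole :: "nat set \<Rightarrow> real \<Rightarrow> bool" where
  "ole U q \<longleftrightarrow> (\<forall>t. real (cnt U t) / 2 ^ t \<le> q)"

definition oge :: "nat set \<Rightarrow> real \<Rightarrow> bool" where
  "oge U q \<longleftrightarrow> (\<forall>r\<in>\<rat>. r < q \<longrightarrow> \<not> ole U r)"

definition gle :: "nat set \<Rightarrow> real \<Rightarrow> bool" where
  "gle G q \<longleftrightarrow> (\<forall>r\<in>\<rat>. q < r \<longrightarrow> (\<exists>n. ole (inter_set G n) r))"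

definition gge :: "nat set \<Rightarrow> real \<Rightarrow> bool" where
  "gge G q \<longleftrightarrow> (\<forall>n. oge (inter_set G n) q)"

lemma sat_open_le:
  assumes "gc M \<xi> e \<nu> d U" "gq q d \<nu>"
  shows "sat M \<nu> \<xi> (open_le U q d e) \<longleftrightarrow> ole (cset M \<xi> e \<nu> d U) (qv \<nu> d q)"
  using assms
  by (simp add: open_le_def sat_cover_count gc_push cset_push ole_def cong: conj_cong)

lemma sat_open_gt:
  assumes "gc M \<xi> e \<nu> d U" "gq q d \<nu>"
  shows "sat M \<nu> \<xi> (open_gt U q d e) \<longleftrightarrow> \<not> ole (cset M \<xi> e \<nu> d U) (qv \<nu> d q)"
  using assms
  by (simp add: open_gt_def sat_cover_count gc_push cset_push ole_def not_le cong: conj_cong)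

lemma sat_open_ge:
  assumes "gc M \<xi> e \<nu> d U" "gq q d \<nu>"
  shows "sat M \<nu> \<xi> (open_ge U q d e) \<longleftrightarrow> oge (cset M \<xi> e \<nu> d U) (qv \<nu> d q)"
  unfolding open_ge_def oge_def
  by (rule sat_nallQ) (use assms in \<open>simp add: sat_open_gt gc_push cset_push\<close>)

lemma sat_open_mem:
  "sat M \<nu> \<xi> (open_mem X U d e) \<longleftrightarrow> (\<exists>\<tau>\<in>cset M \<xi> e \<nu> d U. sinit \<tau> (\<xi> (X e)))"
  by (auto simp: open_mem_def mem_cset[of M _ \<nu> \<xi> U])

lemma sat_open_code:
  assumes "gc M \<xi> e \<nu> d U"
  shows "sat M \<nu> \<xi> (open_code U d e) \<longleftrightarrow> 0 \<notin> cset M \<xi> e \<nu> d U"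
  using gcD[OF assms, of "\<^bold>0"] by (simp add: open_code_def)

lemma cset_elts: "cset M \<xi> e \<nu> d (elts U) = \<xi> (U e)"
  by (simp add: cset_def elts_def)

lemma gc_elts: "gc M \<xi> e \<nu> d (elts U)"
  by (simp add: gc_def cset_elts) (simp add: elts_def)

lemma nev_npair: "nev \<nu> d (npair k n) = pair_code (nev \<nu> d k) (nev \<nu> d n)"
  by (simp add: npair_def pair_code_def)

lemma cset_component: "gd k d \<nu> \<Longrightarrow> cset M \<xi> e \<nu> d (component G k) = comp_set (\<xi> (G e)) (nev \<nu> d k)"
  by (simp add: cset_def component_def nev_npair comp_set_def)

lemma gc_component: "gd k d \<nu> \<Longrightarrow> gc M \<xi> e \<nu> d (component G k)"
  by (simp add: gc_def cset_component) (simp add: component_def nev_npair comp_set_def gd_def)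

lemma sat_component:
  assumes "gd k d \<nu>" "gd s d \<nu>"
  shows "sat M \<nu> \<xi> (component G k s d e) \<longleftrightarrow> nev \<nu> d s \<in> comp_set (\<xi> (G e)) (nev \<nu> d k)"
  using gcD[OF gc_component] assms cset_component by metis

lemma sat_finite_inter:
  assumes "gd n d \<nu>" "gd s d \<nu>"
  shows "sat M \<nu> \<xi> (finite_inter G n s d e) \<longleftrightarrow> nev \<nu> d s \<in> inter_set (\<xi> (G e)) (nev \<nu> d n)"
  using assms by (auto simp: finite_inter_def sat_component inter_set_def)

lemma cset_finite_inter:
  "gd n d \<nu> \<Longrightarrow> cset M \<xi> e \<nu> d (finite_inter G n) = inter_set (\<xi> (G e)) (nev \<nu> d n)"
  by (simp add: cset_def sat_finite_inter)

lemma gc_finite_inter: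
  assumes "gd n d \<nu>"
  shows "gc M \<xi> e \<nu> d (finite_inter G n)"
  unfolding gc_def
proof (intro allI impI)
  fix us s
  assume "gd s (d + length us) (pushes us \<nu>)"
  moreover have "nev (pushes us \<nu>) (d + length us) n = nev \<nu> d n"
    using assms unfolding gd_def by blast
  ultimately show "sat M (pushes us \<nu>) \<xi> (finite_inter G n s (d + length us) e) \<longleftrightarrow>
      nev (pushes us \<nu>) (d + length us) s \<in> cset M \<xi> e \<nu> d (finite_inter G n)"
    using assms by (simp add: sat_finite_inter gd_pushes cset_finite_inter)
qed

lemma sat_seq_code: "sat M \<nu> \<xi> (seq_code G d e) \<longleftrightarrow> (\<forall>k. 0 \<notin> comp_set (\<xi> (G e)) k)"
  by (simp add: seq_code_def sat_open_code gc_component cset_component)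

lemma sat_gdelta_le:
  assumes "gq q d \<nu>"
  shows "sat M \<nu> \<xi> (gdelta_le G q d e) \<longleftrightarrow> gle (\<xi> (G e)) (qv \<nu> d q)"
  unfolding gdelta_le_def gle_def
  by (rule sat_nallQ) (use assms in \<open>simp add: sat_open_le gc_finite_inter cset_finite_inter\<close>)

lemma sat_gdelta_ge:
  assumes "gq q d \<nu>"
  shows "sat M \<nu> \<xi> (gdelta_ge G q d e) \<longleftrightarrow> gge (\<xi> (G e)) (qv \<nu> d q)"
  using assms by (simp add: gdelta_ge_def gge_def sat_open_ge gc_finite_inter cset_finite_inter)

lemma sat_fsigma_ge:
  assumes "gq q d \<nu>"
  shows "sat M \<nu> \<xi> (fsigma_ge G q d e) \<longleftrightarrow> gle (\<xi> (G e)) (1 - qv \<nu> d q)"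
  using assms by (simp add: fsigma_ge_def sat_gdelta_le)

lemma sat_closed_ge:
  assumes "gq q d \<nu>"
  shows "sat M \<nu> \<xi> (closed_ge C q d e) \<longleftrightarrow> ole (\<xi> (C e)) (1 - qv \<nu> d q)"
  using assms by (simp add: closed_ge_def sat_open_le gc_elts cset_elts)

lemma sat_closed_mem:
  "sat M \<nu> \<xi> (closed_mem X C d e) \<longleftrightarrow> \<not> (\<exists>\<tau>\<in>\<xi> (C e). sinit \<tau> (\<xi> (X e)))"
  by (simp add: closed_mem_def sat_open_mem cset_elts)

lemma cnt_le: "cnt U t \<le> 2 ^ t"
  unfolding cnt_def using card_mono[of "{..<2 ^ t}" "{i. i < 2 ^ t \<and> cov U t (2 ^ t + i)}"] by auto

lemma gge_le_1:
  assumes "gge G q"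
  shows "q \<le> 1"
proof (rule ccontr)
  assume "\<not> q \<le> 1"
  then have "\<not> ole (inter_set G 0) 1"
    using assms by (auto simp: gge_def oge_def)
  moreover have "ole U 1" for U
    unfolding ole_def using cnt_le[of U] by (simp add: field_simps)
  ultimately show False by blast
qed


subsection \<open>The regularity principles in an \<open>\<omega>\<close>-model\<close>

definition covers :: "nat set \<Rightarrow> nat set set \<Rightarrow> bool" where
  "covers U M \<longleftrightarrow> 0 \<notin> U \<and> (\<forall>X\<in>M. \<exists>\<tau>\<in>U. sinit \<tau> X)"

lemma svar_simps [simp]:
  "svar e (Suc e) = 0"
  "svar e (Suc (Suc e)) = Suc 0"
  "svar e (Suc (Suc (Suc e))) = Suc (Suc 0)"
  by (simp_all add: svar_def)

lemma qv_qzero [simp]: "qv \<nu> d qzero = 0"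
  by (simp add: qzero_def)

lemma gq_qzero [simp]: "gq qzero d \<nu>"
  by (simp add: qzero_def)

lemmas sat_codes = sat_seq_code sat_open_code gc_elts cset_elts sat_closed_ge sat_gdelta_ge
  sat_closed_mem sat_fsigma_ge

text \<open>If a small open set covers the model, then its complement has no members in the model,
  and so it counts as a subset of any set.\<close>

lemma POS_if_covers:
  assumes "U \<in> M" "covers U M" "ole U (1 / 2)"
  shows "sat M \<nu> \<xi> POS"
proof -
  \<comment> \<open>The witness is 1/2, represented as (1 - 0) / (1 + 1).\<close>
  have "\<exists>a b c. 0 < (real a - real b) / (real c + 1) \<and> ole U (1 - (real a - real b) / (real c + 1))"
    using assms(3) by (intro exI[of _ 1] exI[of _ 0]) simp
  then show ?thesis
    unfolding POS_def sentence_def nexQ_def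
    using assms(2) by (simp add: sat_codes) (auto simp: covers_def intro!: bexI[OF _ assms(1)])
qed

lemma Gdelta_eps_if_covers:
  assumes "\<And>\<epsilon>. 0 < \<epsilon> \<Longrightarrow> \<exists>U\<in>M. covers U M \<and> ole U \<epsilon>"
  shows "sat M \<nu> \<xi> Gdelta_eps"
proof -
  have "\<exists>U\<in>M. covers U M \<and> (\<forall>P q. gge P q \<longrightarrow> ole U (1 - (q - \<epsilon>)))" if "0 < \<epsilon>" for \<epsilon>
  proof -
    obtain U where U: "U \<in> M" "covers U M" "ole U \<epsilon>"
      using assms[OF \<open>0 < \<epsilon>\<close>] by blast
    \<comment> \<open>Since \<open>q\<close> is at most 1, the bound
      \<open>1 - (q - \<epsilon>)\<close> is at least \<epsilon>. The same \<open>U\<close> thus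
      serves every \<open>P\<close>.\<close>
    have "ole U (1 - (q - \<epsilon>))" if "gge P q" for P q
      using U(3) gge_le_1[OF that] unfolding ole_def by (smt (verit))
    with U show ?thesis by blast
  qed
  note * = this
  show ?thesis
    unfolding Gdelta_eps_def sentence_def nallQ_def
    by (simp add: sat_codes del: qminus.simps, intro ballI impI allI, drule *, erule bexE,
        rule_tac x = U in bexI) (auto simp: covers_def)
qed

lemma Gdelta_REG_measure:
  assumes "sat M \<nu> \<xi> Gdelta_REG" "P \<in> M" "\<And>k. 0 \<notin> comp_set P k"
  obtains Q where "Q \<in> M" "\<And>q. q \<in> \<rat> \<Longrightarrow> gle Q (1 - q) \<longleftrightarrow> gge P q"
proof -
  obtain Q where Q: "Q \<in> M" "sat M \<nu> (case_nat Q (case_nat P \<xi>))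
      (nallQ (\<lambda>q. fsigma_ge (svar 1) q \<^bold>\<longleftrightarrow> gdelta_ge (svar 0) q) 0 2)"
    using assms by (auto simp: Gdelta_REG_def sentence_def sat_seq_code numeral_2_eq_2)
  have "sat M \<nu> (case_nat Q (case_nat P \<xi>))
      (nallQ (\<lambda>q. fsigma_ge (svar 1) q \<^bold>\<longleftrightarrow> gdelta_ge (svar 0) q) 0 2)
    \<longleftrightarrow> (\<forall>q\<in>\<rat>. gle Q (1 - q) \<longleftrightarrow> gge P q)"
    by (rule sat_nallQ) (simp add: sat_codes numeral_2_eq_2)
  with Q that show thesis by blast
qed


section \<open>Counting strings\<close>

text \<open>The conjunct \<open>l \<le> t\<close> empties the set for longer prefixes, so that the
  bound in \<open>card_cyl_le\<close> holds for all lengths.\<close>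

definition cyl :: "nat \<Rightarrow> nat \<Rightarrow> (nat \<Rightarrow> bool) \<Rightarrow> nat set" where
  "cyl t l w = {i. i < 2 ^ t \<and> l \<le> t \<and> (\<forall>j<l. bit i j \<longleftrightarrow> w j)}"

lemma finite_cyl [simp]: "finite (cyl t l w)"
  unfolding cyl_def by simp

lemma number_with_bits:
  obtains u :: nat where "u < 2 ^ l" "\<And>j. j < l \<Longrightarrow> bit u j \<longleftrightarrow> w j"
proof
  let ?u = "horner_sum of_bool 2 (map w [0..<l]) :: nat"
  show "?u < 2 ^ l"
    using horner_sum_of_bool_2_less[of "map w [0..<l]"] by simp
  show "bit ?u j \<longleftrightarrow> w j" if "j < l" for j
    using that by (simp add: bit_horner_sum_bit_iff)
qed

lemma card_cyl:
  assumes "l \<le> t"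
  shows "card (cyl t l w) = 2 ^ (t - l)"
proof -
  obtain u :: nat where u: "u < 2 ^ l" "\<And>j. j < l \<Longrightarrow> bit u j \<longleftrightarrow> w j"
    by (rule number_with_bits[of l w]) blast
  have bits: "(\<forall>j<l. bit i j \<longleftrightarrow> w j) \<longleftrightarrow> i mod 2 ^ l = u" for i :: nat
  proof
    assume "\<forall>j<l. bit i j \<longleftrightarrow> w j"
    then have "take_bit l i = take_bit l u"
      using u(2) by (auto simp: bit_eq_iff bit_take_bit_iff)
    then show "i mod 2 ^ l = u" using u(1) by (simp add: take_bit_eq_mod)
  next
    assume "i mod 2 ^ l = u"
    then have "take_bit l i = u" by (simp add: take_bit_eq_mod)
    then show "\<forall>j<l. bit i j \<longleftrightarrow> w j" using u(2) by (auto simp: bit_take_bit_iff)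
  qed
  have t: "2 ^ t = 2 ^ (t - l) * (2 ^ l :: nat)"
    using assms by (simp flip: power_add)
  have "bij_betw (\<lambda>j. j * 2 ^ l + u) {..<2 ^ (t - l)} (cyl t l w)"
  proof (rule bij_betw_byWitness[where f' = "\<lambda>i. i div 2 ^ l"])
    show "(\<lambda>j. j * 2 ^ l + u) ` {..<2 ^ (t - l)} \<subseteq> cyl t l w"
    proof
      fix i assume "i \<in> (\<lambda>j. j * 2 ^ l + u) ` {..<2 ^ (t - l)}"
      then obtain j where j: "i = j * 2 ^ l + u" "j < 2 ^ (t - l)" by blast
      then have "Suc j * 2 ^ l \<le> 2 ^ t" unfolding t by (intro mult_right_mono) auto
      then show "i \<in> cyl t l w" using u(1) assms j(1) by (simp add: cyl_def bits)
    qed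
    show "(\<lambda>i. i div 2 ^ l) ` cyl t l w \<subseteq> {..<2 ^ (t - l)}"
      by (auto simp: cyl_def t div_less_iff_less_mult)
    show "\<forall>i\<in>cyl t l w. i div 2 ^ l * 2 ^ l + u = i"
      unfolding cyl_def bits by (auto simp: div_mult_mod_eq)
  qed (use u(1) in simp)
  then show ?thesis
    using bij_betw_same_card by fastforce
qed

lemma card_cyl_real: "l \<le> t \<Longrightarrow> real (card (cyl t l w)) = 2 ^ t / 2 ^ l"
  by (simp add: card_cyl) (simp add: power_diff)

lemma card_cyl_le: "real (card (cyl t l w)) \<le> 2 ^ t / 2 ^ l"
proof (cases "l \<le> t")
  case False
  then have "cyl t l w = {}" by (auto simp: cyl_def)
  then show ?thesis by simp
qed (simp add: card_cyl_real)

lemma card_UN_cyl_le: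
  assumes "finite I"
  shows "real (card (\<Union>i\<in>I. cyl t (l i) (w i))) \<le> 2 ^ t * (\<Sum>i\<in>I. 1 / 2 ^ l i)"
proof -
  have "real (card (\<Union>i\<in>I. cyl t (l i) (w i))) \<le> (\<Sum>i\<in>I. real (card (cyl t (l i) (w i))))"
    using card_UN_le[OF assms, of "\<lambda>i. cyl t (l i) (w i)"] by (simp flip: of_nat_sum)
  also have "\<dots> \<le> (\<Sum>i\<in>I. 2 ^ t / 2 ^ l i)"
    by (intro sum_mono card_cyl_le)
  finally show ?thesis by (simp add: sum_distrib_left)
qed

section \<open>Strings as numbers and the strings that they cover\<close>

lemma slen_unique:
  assumes "slen \<tau> m" "slen \<tau> n"
  shows "m = n"
proof -
  have False if "slen \<tau> a" "slen \<tau> b" "a < b" for a b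
  proof -
    have "(2::nat) ^ Suc a \<le> 2 ^ b" using that by (intro power_increasing) auto
    with that show False by (simp add: slen_def)
  qed
  with assms show ?thesis by (meson nat_neq_iff)
qed

lemma slen_less: "slen \<tau> n \<Longrightarrow> n < \<tau>"
  unfolding slen_def using less_exp[of n] by linarith

lemma slen_string: "i < 2 ^ t \<Longrightarrow> slen (2 ^ t + i) t"
  by (simp add: slen_def)

lemma bit_string:
  assumes "i < 2 ^ t" "j < t"
  shows "bit (2 ^ t + i) j \<longleftrightarrow> bit (i :: nat) j"
proof -
  have "take_bit t (2 ^ t + i) = take_bit t i" by (simp add: take_bit_eq_mod)
  then show ?thesis using assms(2) by (metis bit_take_bit_iff)
qed

lemma string_with_bits:
  obtains \<tau> where "slen \<tau> n" "\<And>j. j < n \<Longrightarrow> bit \<tau> j \<longleftrightarrow> w j"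
proof -
  obtain u :: nat where "u < 2 ^ n" "\<And>j. j < n \<Longrightarrow> bit u j \<longleftrightarrow> w j"
    by (rule number_with_bits[of n w]) blast
  then show thesis using that[of "2 ^ n + u"] by (simp add: slen_string bit_string)
qed

lemma cov_iff:
  assumes "i < 2 ^ t"
  shows "cov U t (2 ^ t + i) \<longleftrightarrow>
    (\<exists>\<tau>\<in>U. \<exists>n<t. slen \<tau> n \<and> (\<forall>j<n. bit \<tau> j \<longleftrightarrow> bit i j))"
proof
  assume "cov U t (2 ^ t + i)"
  then obtain \<tau> n m n' where \<tau>: "\<tau> \<in> U" "slen \<tau> n" "n < t" "slen \<tau> m"
    "\<forall>j<m. bit \<tau> j \<longleftrightarrow> bit (2 ^ t + i) j"
    unfolding cov_def sprefix_def by blast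
  then have "m = n" using slen_unique by blast
  then show "\<exists>\<tau>\<in>U. \<exists>n<t. slen \<tau> n \<and> (\<forall>j<n. bit \<tau> j \<longleftrightarrow> bit i j)"
    using \<tau> assms by (metis bit_string less_trans)
next
  assume "\<exists>\<tau>\<in>U. \<exists>n<t. slen \<tau> n \<and> (\<forall>j<n. bit \<tau> j \<longleftrightarrow> bit i j)"
  then obtain \<tau> n where \<tau>: "\<tau> \<in> U" "n < t" "slen \<tau> n" "\<forall>j<n. bit \<tau> j \<longleftrightarrow> bit i j" by blast
  then have "sprefix \<tau> (2 ^ t + i)"
    unfolding sprefix_def using assms
    by (intro exI[of _ n] exI[of _ t]) (simp add: slen_string bit_string)
  with \<tau> show "cov U t (2 ^ t + i)" unfolding cov_def by blast
qed

lemma ole_if_subset: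
  assumes "\<And>t. {i. i < 2 ^ t \<and> cov U t (2 ^ t + i)} \<subseteq> A t" "\<And>t. finite (A t)"
    and "\<And>t. real (card (A t)) \<le> 2 ^ t * q"
  shows "ole U q"
  unfolding ole_def cnt_def
proof
  fix t
  have "real (card {i. i < 2 ^ t \<and> cov U t (2 ^ t + i)}) \<le> real (card (A t))"
    using assms(1,2) by (simp add: card_mono)
  also note assms(3)
  finally show "real (card {i. i < 2 ^ t \<and> cov U t (2 ^ t + i)}) / 2 ^ t \<le> q"
    by (simp add: field_simps)
qed

lemma cnt_mono: "U \<subseteq> V \<Longrightarrow> cnt U t \<le> cnt V t"
  unfolding cnt_def cov_def by (intro card_mono) auto

lemma inter_set_mono: "G \<subseteq> H \<Longrightarrow> inter_set G n \<subseteq> inter_set H n"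
  unfolding inter_set_def comp_set_def by blast


section \<open>A small open set that covers the model\<close>

definition cover_set :: "nat \<Rightarrow> nat set" where
  "cover_set k = {\<tau>. cover_str sems k \<tau>}"

lemma decided_cong: "T s = T' s \<Longrightarrow> decided T l e s \<longleftrightarrow> decided T' l e s"
  by (simp add: decided_def)

text \<open>A string of length \<open>n\<close> is a number above \<open>n\<close>, and only stages
  up to \<open>n\<close> are consulted. So the truncated table available to the atom
  \<open>Cover\<close> gives the correct answer.\<close>

lemma cover_str_cong:
  assumes "\<And>s. s < \<tau> \<Longrightarrow> T s = T' s"
  shows "cover_str T k \<tau> \<longleftrightarrow> cover_str T' k \<tau>"
proof -
  have "cover_str T' k \<tau>" if T: "\<And>s. s < \<tau> \<Longrightarrow> T s = T' s" and cover: "cover_str T k \<tau>" for T T'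
  proof -
    obtain n e s where *: "slen \<tau> n" "s \<le> n" "e + k + 1 \<le> n" "decided T (e + k + 1) e s"
      "\<forall>s'<s. \<not> decided T (e + k + 1) e s'"
      "\<forall>i<e + k + 1. bit \<tau> i \<longleftrightarrow> T s (pos_part e) [i]"
      using cover unfolding cover_str_def by blast
    have eq: "T s' = T' s'" if "s' \<le> s" for s'
      using T slen_less[OF *(1)] *(2) that by simp
    have "decided T' (e + k + 1) e s"
      using decided_cong[where T = T and T' = T', OF eq[OF order_refl]] *(4) by blast
    moreover have "\<forall>s'<s. \<not> decided T' (e + k + 1) e s'"
      using decided_cong[where T = T and T' = T', OF eq[OF less_imp_le]] *(5) by blast
    moreover have "\<forall>i<e + k + 1. bit \<tau> i \<longleftrightarrow> T' s (pos_part e) [i]"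
      using *(6) eq[of s] by simp
    ultimately show ?thesis
      unfolding cover_str_def using *(1-3) by blast
  qed
  from this[of T T'] this[of T' T] assms show ?thesis by metis
qed

lemma cover_set_Rec: "cover_set k \<in> Rec"
proof -
  have "cover_str (\<lambda>s q y. s < \<tau> \<and> sems s q y) k \<tau> \<longleftrightarrow> \<tau> \<in> cover_set k" for \<tau>
    unfolding cover_set_def mem_Collect_eq by (rule cover_str_cong) auto
  then show ?thesis
    by (intro RecI[of "Fn True (Cover k)" _ "Fn False (Cover k)"]) (simp_all add: sem_Fn env_def)
qed

text \<open>A code \<open>(p, q)\<close> of \<open>X\<close> decides any finite range by some stage.
  What is verified at a stage is true, so the string read off at the first such stage agrees with
  \<open>X\<close>.\<close>

lemma covers_cover_set: "covers (cover_set k) Rec"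
  unfolding covers_def
proof (intro conjI ballI)
  show "0 \<notin> cover_set k"
    by (simp add: cover_set_def cover_str_def slen_def)
next
  fix X assume "X \<in> Rec"
  then obtain p q where p: "\<And>n. sem p [n] \<longleftrightarrow> n \<in> X" and q: "\<And>n. sem q [n] \<longleftrightarrow> n \<notin> X"
    by (rule Rec_codes) blast
  define e where "e = to_nat (p, q)"
  have parts: "pos_part e = p" "neg_part e = q"
    by (simp_all add: e_def pos_part_def neg_part_def)
  have "sem (Disj p q) [i]" for i using p q by (simp add: sem_Disj)
  then obtain s0 where "\<And>i. i < e + k + 1 \<Longrightarrow> sems s0 (Disj p q) [i]"
    using sem_uniform_stage[of "e + k + 1" "\<lambda>_. Disj p q" "\<lambda>i. [i]"] by blast
  then have s0: "decided sems (e + k + 1) e s0"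
    by (simp add: decided_def parts)
  define s where "s = (LEAST s. decided sems (e + k + 1) e s)"
  have s: "decided sems (e + k + 1) e s" "\<And>s'. s' < s \<Longrightarrow> \<not> decided sems (e + k + 1) e s'"
    unfolding s_def using s0 by (rule LeastI) (rule not_less_Least)
  have val: "sems s p [i] \<longleftrightarrow> i \<in> X" if "i < e + k + 1" for i
  proof -
    have "sems s p [i] \<or> sems s q [i]"
      using s(1) that by (simp add: decided_def parts)
    moreover have "sems s p [i] \<Longrightarrow> i \<in> X" "sems s q [i] \<Longrightarrow> i \<notin> X"
      using p q unfolding sem_def by blast+
    ultimately show ?thesis by blast
  qed
  obtain \<tau> where \<tau>: "slen \<tau> (max s (e + k + 1))"
    "\<And>j. j < max s (e + k + 1) \<Longrightarrow> bit \<tau> j \<longleftrightarrow> j \<in> X"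
    by (rule string_with_bits[of "max s (e + k + 1)" "\<lambda>j. j \<in> X"]) blast
  have "cover_str sems k \<tau>"
    unfolding cover_str_def
    by (intro exI[of _ "max s (e + k + 1)"] exI[of _ e] exI[of _ s] conjI)
      (use \<tau> s val in \<open>simp_all add: parts\<close>)
  moreover have "sinit \<tau> X"
    using \<tau> unfolding sinit_def by blast
  ultimately show "\<exists>\<tau>\<in>cover_set k. sinit \<tau> X"
    unfolding cover_set_def by blast
qed

lemma sum_half_powers: "(\<Sum>e<N. 1 / 2 ^ (e + k + 1)) \<le> (1 / 2 ^ k :: real)"
proof -
  have "(\<Sum>e<N. 1 / 2 ^ (e + k + 1)) = (1 / 2 ^ k) * (1 - 1 / 2 ^ N :: real)"
    by (induction N) (simp_all add: field_simps power_add)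
  also have "\<dots> \<le> (1 / 2 ^ k) * 1"
    by (intro mult_left_mono) auto
  finally show ?thesis by simp
qed

lemma ole_cover_set: "ole (cover_set k) (1 / 2 ^ k)"
proof -
  \<comment> \<open>For an index that is never decided, the least stage is an arbitrary number. Its
    cylinder is then counted as well, which an upper bound permits.\<close>
  define w where "w e i \<longleftrightarrow> sems (LEAST s. decided sems (e + k + 1) e s) (pos_part e) [i]" for e i
  show ?thesis
  proof (rule ole_if_subset[where A = "\<lambda>t. \<Union>e<t. cyl t (e + k + 1) (w e)"])
    fix t
    show "{i. i < 2 ^ t \<and> cov (cover_set k) t (2 ^ t + i)} \<subseteq> (\<Union>e<t. cyl t (e + k + 1) (w e))"
    proof
      fix i assume "i \<in> {i. i < 2 ^ t \<and> cov (cover_set k) t (2 ^ t + i)}"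
      then obtain \<tau> n where *: "i < 2 ^ t" "cover_str sems k \<tau>" "n < t" "slen \<tau> n"
        "\<forall>j<n. bit \<tau> j \<longleftrightarrow> bit i j"
        by (auto simp: cov_iff cover_set_def)
      then obtain e s where e: "e + k + 1 \<le> n" "decided sems (e + k + 1) e s"
        "\<forall>s'<s. \<not> decided sems (e + k + 1) e s'"
        "\<forall>i<e + k + 1. bit \<tau> i \<longleftrightarrow> sems s (pos_part e) [i]"
        unfolding cover_str_def using slen_unique[OF *(4)] by blast
      have "(LEAST s. decided sems (e + k + 1) e s) = s"
        using e(2,3) by (intro Least_equality) (auto simp: not_less[symmetric])
      then have "i \<in> cyl t (e + k + 1) (w e)"
        using * e by (auto simp: cyl_def w_def)
      then show "i \<in> (\<Union>e<t. cyl t (e + k + 1) (w e))"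
        using e(1) *(3) by (intro UN_I[of e]) auto
    qed
    show "real (card (\<Union>e<t. cyl t (e + k + 1) (w e))) \<le> 2 ^ t * (1 / 2 ^ k)"
      by (rule order_trans[OF card_UN_cyl_le mult_left_mono[OF sum_half_powers]]) auto
  qed simp
qed

theorem Rec_POS: "sat Rec \<nu> \<xi> POS"
  using POS_if_covers[OF cover_set_Rec covers_cover_set] ole_cover_set[of 1] by simp

theorem Rec_Gdelta_eps: "sat Rec \<nu> \<xi> Gdelta_eps"
proof (rule Gdelta_eps_if_covers)
  fix \<epsilon> :: real assume "0 < \<epsilon>"
  then obtain k where "(1 / 2) ^ k < \<epsilon>"
    using real_arch_pow_inv[of \<epsilon> "1 / 2"] by auto
  then have "ole (cover_set k) \<epsilon>"
    using ole_cover_set[of k] unfolding ole_def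
    by (metis less_imp_le order_trans power_one_over)
  then show "\<exists>U\<in>Rec. covers U Rec \<and> ole U \<epsilon>"
    using cover_set_Rec covers_cover_set by blast
qed


section \<open>Failure of regularity in the model\<close>

definition cylinders :: "nat set" where
  "cylinders = {x. cylinder_str sems x}"

definition total_codes :: "nat set" where
  "total_codes = {e. \<forall>n. sem (from_nat e) [e, n]}"

text \<open>The code lies in the interval from the square of \<open>k + m\<close> to just below the
  next square, so it determines \<open>k + m\<close>, and then \<open>k\<close>.\<close>

lemma pair_code_inj: "pair_code k m = pair_code k' m' \<longleftrightarrow> k = k' \<and> m = m'"
proof
  have less: "pair_code k m < pair_code k' m'" if "k + m < k' + m'" for k m k' m'
  proof -
    have "pair_code k m < (k + m + 1) * (k + m + 1)" by (simp add: pair_code_def algebra_simps)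
    also have "\<dots> \<le> (k' + m') * (k' + m')" using that by (intro mult_mono) auto
    also have "\<dots> \<le> pair_code k' m'" by (simp add: pair_code_def)
    finally show ?thesis .
  qed
  assume eq: "pair_code k m = pair_code k' m'"
  have "k + m = k' + m'"
    using less[of k m k' m'] less[of k' m' k m] eq by (metis nat_neq_iff)
  with eq show "k = k' \<and> m = m'" by (simp add: pair_code_def)
qed simp

lemma le_pair_code: "n \<le> pair_code k n"
  unfolding pair_code_def by (simp add: add_mult_distrib trans_le_add1 le_square trans_le_add2)

lemma cylinder_str_cong:
  assumes "\<And>s. s < x \<Longrightarrow> T s = T' s"
  shows "cylinder_str T x \<longleftrightarrow> cylinder_str T' x"
proof -
  have "cylinder_str T' x" if T: "\<And>s. s < x \<Longrightarrow> T s = T' s" and cyl: "cylinder_str T x" for T T'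
  proof -
    obtain k \<tau> l e where *: "x = pair_code k \<tau>" "slen \<tau> l" "3 * e + 1 \<le> l" "lead e \<tau>"
      "T l (from_nat e) [e, k]"
      using cyl unfolding cylinder_str_def by blast
    have "l < x" using slen_less[OF *(2)] le_pair_code[of \<tau> k] *(1) by simp
    with * T show ?thesis unfolding cylinder_str_def by metis
  qed
  from this[of T T'] this[of T' T] assms show ?thesis by metis
qed

lemma cylinders_Rec: "cylinders \<in> Rec"
proof -
  have "cylinder_str (\<lambda>s q y. s < x \<and> sems s q y) x \<longleftrightarrow> x \<in> cylinders" for x
    unfolding cylinders_def mem_Collect_eq by (rule cylinder_str_cong) auto
  then show ?thesis
    by (intro RecI[of "Fn True Cylinders" _ "Fn False Cylinders"]) (simp_all add: sem_Fn env_def)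
qed

lemma comp_set_cylinders:
  "\<tau> \<in> comp_set cylinders k \<longleftrightarrow>
    (\<exists>l e. slen \<tau> l \<and> 3 * e + 1 \<le> l \<and> lead e \<tau> \<and> sems l (from_nat e) [e, k])"
  by (auto simp: comp_set_def cylinders_def cylinder_str_def pair_code_inj)

lemma zero_notin_cylinders: "0 \<notin> comp_set cylinders k"
  by (simp add: comp_set_cylinders slen_def)

section \<open>Measure bounds for the finite intersections of the cylinders\<close>

lemma lead_unique: "lead a \<tau> \<Longrightarrow> lead b \<tau> \<Longrightarrow> a = b"
proof -
  have False if "lead a \<tau>" "lead b \<tau>" "a < b" for a b
    using that(1)[unfolded lead_def, rule_format, of "3 * a"]
      that(2)[unfolded lead_def, rule_format, of "3 * a"] that(3) by simp
  then show "lead a \<tau> \<Longrightarrow> lead b \<tau> \<Longrightarrow> a = b" by (meson nat_neq_iff)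
qed

text \<open>Each component might supply a different index, but all of them describe the position of
  the first 1 in \<sigma> and so coincide.\<close>

lemma inter_set_cylindersD:
  assumes "\<sigma> \<in> inter_set cylinders n" "slen \<sigma> l"
  obtains e where "lead e \<sigma>" "3 * e + 1 \<le> l" "\<And>k. k \<le> n \<Longrightarrow> sem (from_nat e) [e, k]"
proof -
  have *: "\<exists>e. lead e \<sigma> \<and> 3 * e + 1 \<le> l \<and> sem (from_nat e) [e, k]" if "k \<le> n" for k
  proof -
    obtain \<tau> where \<tau>: "\<tau> \<in> comp_set cylinders k" "sprefix \<tau> \<sigma>"
      using assms(1) \<open>k \<le> n\<close> unfolding inter_set_def by blast
    then obtain m e where e: "slen \<tau> m" "3 * e + 1 \<le> m" "lead e \<tau>" "sems m (from_nat e) [e, k]"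
      unfolding comp_set_cylinders by blast
    have m: "m \<le> l" "\<forall>i<m. bit \<tau> i \<longleftrightarrow> bit \<sigma> i"
      using \<tau>(2) assms(2) e(1) slen_unique unfolding sprefix_def by blast+
    then have "lead e \<sigma>"
      using e(2,3) unfolding lead_def by (metis less_le_trans)
    with e m show ?thesis unfolding sem_def by (intro exI[of _ e]) auto
  qed
  from *[of 0] obtain e where "lead e \<sigma>" "3 * e + 1 \<le> l" by auto
  with * that lead_unique show thesis by metis
qed

text \<open>Every index up to \<open>e\<close> outside of \<open>F\<close> fails at some argument.
  For \<open>n\<close> past these arguments, only the cylinders of \<open>F\<close> and strings from
  indices beyond \<open>e\<close> remain; the latter begin with \<open>3 * e + 3\<close>
  zeros.\<close>

lemma ole_inter_cylinders:
  assumes "e \<notin> total_codes" "total_codes \<inter> {..<e} \<subseteq> F" "F \<subseteq> {..<e}"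
  shows "\<exists>n. ole (inter_set cylinders n) (weight F + 1 / 2 ^ (3 * e + 3))"
proof -
  have finF: "finite F" using assms(3) finite_subset by blast
  have "\<exists>n. i \<notin> F \<longrightarrow> \<not> sem (from_nat i) [i, n]" if "i < Suc e" for i
    using assms(1,2) that unfolding total_codes_def by (cases "i = e") auto
  then obtain f where f: "\<And>i. i < Suc e \<Longrightarrow> i \<notin> F \<Longrightarrow> \<not> sem (from_nat i) [i, f i]"
    by metis
  define n where "n = (\<Sum>i\<le>e. f i)"
  have n: "f i \<le> n" if "i < Suc e" for i
    unfolding n_def using that by (intro member_le_sum) auto
  \<comment> \<open>As \<open>e\<close> is not in \<open>F\<close>, it is free to label the tail,
    the cylinder of \<open>3 * e + 3\<close> zeros.\<close>
  define l where "l i = (if i < e then 3 * i + 1 else 3 * e + 3)" for i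
  define w where "w i j \<longleftrightarrow> i < e \<and> j = 3 * i" for i j
  have "ole (inter_set cylinders n) (weight F + 1 / 2 ^ (3 * e + 3))"
  proof (rule ole_if_subset[where A = "\<lambda>t. \<Union>i\<in>insert e F. cyl t (l i) (w i)"])
    fix t
    show "{i. i < 2 ^ t \<and> cov (inter_set cylinders n) t (2 ^ t + i)}
      \<subseteq> (\<Union>i\<in>insert e F. cyl t (l i) (w i))"
    proof
      fix x assume "x \<in> {i. i < 2 ^ t \<and> cov (inter_set cylinders n) t (2 ^ t + i)}"
      then obtain \<sigma> m where *: "x < 2 ^ t" "\<sigma> \<in> inter_set cylinders n" "m < t" "slen \<sigma> m"
        "\<forall>j<m. bit \<sigma> j \<longleftrightarrow> bit x j"
        by (auto simp: cov_iff)
      obtain a where a: "lead a \<sigma>" "3 * a + 1 \<le> m" "\<And>k. k \<le> n \<Longrightarrow> sem (from_nat a) [a, k]"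
        using inter_set_cylindersD[OF *(2,4)] by blast
      have x: "\<forall>j<3 * a + 1. bit x j \<longleftrightarrow> j = 3 * a"
        using a(1,2) *(5) unfolding lead_def by (metis less_le_trans)
      show "x \<in> (\<Union>i\<in>insert e F. cyl t (l i) (w i))"
      proof (cases "a \<in> F")
        case True
        then have "x \<in> cyl t (l a) (w a)"
          using x * a(2) assms(3) by (auto simp: cyl_def l_def w_def)
        with True show ?thesis by blast
      next
        case False
        then have "e < a"
          using f[of a] n[of a] a(3)[of "f a"] by (meson less_Suc_eq_le not_less)
        then have "x \<in> cyl t (l e) (w e)"
          using x * a(2) by (auto simp: cyl_def l_def w_def)
        then show ?thesis by blast
      qed
    qed
    have "(\<Sum>i\<in>insert e F. 1 / 2 ^ l i) = 1 / 2 ^ (3 * e + 3) + (\<Sum>i\<in>F. 1 / 2 ^ l i :: real)"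
      using finF assms(3) by (subst sum.insert) (auto simp: l_def)
    also have "(\<Sum>i\<in>F. 1 / 2 ^ l i :: real) = weight F"
      unfolding weight_def using assms(3) by (intro sum.cong) (auto simp: l_def)
    finally show "real (card (\<Union>i\<in>insert e F. cyl t (l i) (w i)))
      \<le> 2 ^ t * (weight F + 1 / 2 ^ (3 * e + 3))"
      using card_UN_cyl_le[of "insert e F" t l w] finF by (simp add: add.commute)
  qed (use finF in simp)
  then show ?thesis by blast
qed

lemma inter_set_cylindersI:
  assumes "slen \<sigma> l" "lead i \<sigma>" "3 * i + 1 \<le> l" "\<And>k. k \<le> n \<Longrightarrow> sems l (from_nat i) [i, k]"
  shows "\<sigma> \<in> inter_set cylinders n"
proof -
  have "\<sigma> \<in> comp_set cylinders k" if "k \<le> n" for k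
    unfolding comp_set_cylinders using assms that by blast
  moreover have "sprefix \<sigma> \<sigma>" unfolding sprefix_def using assms(1) by blast
  ultimately show ?thesis unfolding inter_set_def by blast
qed

text \<open>The members below \<open>e\<close> are verified for all \<open>k \<le> n\<close> by a
  common stage, and from this length on all strings of their cylinders lie in the finite
  intersection.\<close>

lemma gge_cylinders: "gge cylinders (weight (total_codes \<inter> {..<e}))"
  unfolding gge_def oge_def
proof (intro allI ballI impI)
  fix n and r :: real
  assume r: "r < weight (total_codes \<inter> {..<e})"
  let ?F = "total_codes \<inter> {..<e}"
  have "\<exists>s. i \<in> total_codes \<longrightarrow> (\<forall>k<Suc n. sems s (from_nat i) [i, k])" for i
    using sem_uniform_stage[of "Suc n" "\<lambda>_. from_nat i" "\<lambda>k. [i, k]"] unfolding total_codes_def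
    by blast
  then have "\<exists>s. \<forall>i<e. i \<in> total_codes \<longrightarrow> (\<forall>k<Suc n. sems s (from_nat i) [i, k])"
    using sems_mono by (intro uniform_stage) blast+
  then obtain s where s: "\<And>i k. i < e \<Longrightarrow> i \<in> total_codes \<Longrightarrow> k \<le> n \<Longrightarrow> sems s (from_nat i) [i, k]"
    by (meson less_Suc_eq_le)
  \<comment> \<open>Length \<open>s\<close> reaches the common stage, and length
    \<open>3 * e\<close> passes the leading 1 of each index below \<open>e\<close>. The count is
    taken at level \<open>Suc l\<close> because \<open>cov\<close> admits only strings shorter than
    the level.\<close>
  define l where "l = max s (3 * e)"
  define w where "w i j \<longleftrightarrow> j = 3 * i" for i j :: nat
  have sub: "(\<Union>i\<in>?F. cyl (Suc l) (3 * i + 1) (w i))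
    \<subseteq> {x. x < 2 ^ Suc l \<and> cov (inter_set cylinders n) (Suc l) (2 ^ Suc l + x)}"
  proof
    fix x assume "x \<in> (\<Union>i\<in>?F. cyl (Suc l) (3 * i + 1) (w i))"
    then obtain i where i: "i \<in> total_codes" "i < e" "x < 2 ^ Suc l"
      "\<forall>j<3 * i + 1. bit x j \<longleftrightarrow> j = 3 * i"
      by (auto simp: cyl_def w_def)
    have il: "3 * i + 1 \<le> l" using i(2) by (simp add: l_def)
    obtain \<sigma> where \<sigma>: "slen \<sigma> l" "\<And>j. j < l \<Longrightarrow> bit \<sigma> j \<longleftrightarrow> bit x j"
      by (rule string_with_bits[of l "bit x"]) blast
    have "\<sigma> \<in> inter_set cylinders n"
    proof (rule inter_set_cylindersI[OF \<sigma>(1) _ il])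
      show "lead i \<sigma>" using i(4) il \<sigma>(2) by (simp add: lead_def)
      show "sems l (from_nat i) [i, k]" if "k \<le> n" for k
        using s[OF i(2,1) that] by (rule sems_mono) (simp add: l_def)
    qed
    then have "cov (inter_set cylinders n) (Suc l) (2 ^ Suc l + x)"
      unfolding cov_iff[OF i(3)] using \<sigma> by blast
    with i(3) show "x \<in> {x. x < 2 ^ Suc l \<and> cov (inter_set cylinders n) (Suc l) (2 ^ Suc l + x)}"
      by blast
  qed
  have "2 ^ Suc l * weight ?F = (\<Sum>i\<in>?F. 2 ^ Suc l / 2 ^ (3 * i + 1))"
    by (simp add: weight_def sum_distrib_left)
  also have "\<dots> = (\<Sum>i\<in>?F. real (card (cyl (Suc l) (3 * i + 1) (w i))))"
    by (intro sum.cong refl card_cyl_real[symmetric]) (auto simp: l_def)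
  also have "\<dots> = real (card (\<Union>i\<in>?F. cyl (Suc l) (3 * i + 1) (w i)))"
  proof -
    have "cyl (Suc l) (3 * i + 1) (w i) \<inter> cyl (Suc l) (3 * j + 1) (w j) = {}" if "i \<noteq> j" for i j
      using that lead_unique[of i _ j] by (auto simp: cyl_def w_def lead_def)
    then show ?thesis by (subst card_UN_disjoint) auto
  qed
  also have "\<dots> \<le> real (cnt (inter_set cylinders n) (Suc l))"
    unfolding cnt_def by (intro of_nat_mono card_mono sub) auto
  finally have "weight ?F \<le> real (cnt (inter_set cylinders n) (Suc l)) / 2 ^ Suc l"
    by (simp add: field_simps)
  with r show "\<not> ole (inter_set cylinders n) r"
    unfolding ole_def by (meson not_less less_le_trans)
qed

text \<open>Compactness: each of the finitely many covered strings at level \<open>t\<close> needs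
  one element from each of finitely many components, and all of these have entered by some stage. So
  the count is reached by an approximation of \<open>Q\<close>, which is all that
  \<open>refuted\<close> sees.\<close>

lemma cnt_inter_stage:
  fixes R :: "nat \<Rightarrow> nat set"
  assumes Q: "\<And>x. x \<in> Q \<longleftrightarrow> (\<exists>s. x \<in> R s)" and mono: "\<And>s s'. s \<le> s' \<Longrightarrow> R s \<subseteq> R s'"
  shows "\<exists>s. cnt (inter_set Q n) t \<le> cnt (inter_set (R s) n) t"
proof -
  have stage: "\<exists>s. \<sigma> \<in> inter_set (R s) n" if \<sigma>: "\<sigma> \<in> inter_set Q n" for \<sigma>
  proof -
    have ex: "\<exists>s. \<exists>\<tau>\<in>comp_set (R s) k. sprefix \<tau> \<sigma>" if "k < Suc n" for k
      using \<sigma> that Q unfolding inter_set_def comp_set_def less_Suc_eq_le by blast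
    have "\<exists>s. \<forall>k<Suc n. \<exists>\<tau>\<in>comp_set (R s) k. sprefix \<tau> \<sigma>"
    proof (rule uniform_stage)
      show "\<exists>s. \<exists>\<tau>\<in>comp_set (R s) k. sprefix \<tau> \<sigma>" if "k < Suc n" for k
        using ex[OF that] .
      show "\<exists>\<tau>\<in>comp_set (R s') k. sprefix \<tau> \<sigma>"
        if "\<exists>\<tau>\<in>comp_set (R s) k. sprefix \<tau> \<sigma>" "s \<le> s'" for s s' k
        using that(1) mono[OF that(2)] unfolding comp_set_def by blast
    qed
    then show ?thesis unfolding inter_set_def by (auto simp: less_Suc_eq_le)
  qed
  have "\<exists>s. cov (inter_set Q n) t (2 ^ t + i) \<longrightarrow> cov (inter_set (R s) n) t (2 ^ t + i)" for i
    using stage unfolding cov_def by blast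
  then have "\<exists>s. \<forall>i<2 ^ t. cov (inter_set Q n) t (2 ^ t + i) \<longrightarrow> cov (inter_set (R s) n) t (2 ^ t + i)"
    using inter_set_mono[OF mono] unfolding cov_def by (intro uniform_stage) blast+
  then obtain s where
    "\<forall>i<2 ^ t. cov (inter_set Q n) t (2 ^ t + i) \<longrightarrow> cov (inter_set (R s) n) t (2 ^ t + i)" by blast
  then have "cnt (inter_set Q n) t \<le> cnt (inter_set (R s) n) t"
    unfolding cnt_def by (intro card_mono) auto
  then show ?thesis by blast
qed

lemma weight_Rats: "weight F \<in> \<rat>"
  unfolding weight_def by (intro Rats_sum Rats_divide Rats_power) auto

theorem Rec_not_Gdelta_REG: "\<not> sat Rec \<nu> \<xi> Gdelta_REG"
proof
  assume "sat Rec \<nu> \<xi> Gdelta_REG"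
  then obtain Q where Q: "Q \<in> Rec" and measure: "\<And>q. q \<in> \<rat> \<Longrightarrow> gle Q (1 - q) \<longleftrightarrow> gge cylinders q"
    by (rule Gdelta_REG_measure[OF _ cylinders_Rec zero_notin_cylinders]) blast
  obtain a where a: "\<And>x. sem a [x] \<longleftrightarrow> x \<in> Q"
    using Q by (rule Rec_codes) blast
  define R where "R s = {x. sems s a [x]}" for s
  have R_mono: "R s \<subseteq> R s'" if "s \<le> s'" for s s'
    using that sems_mono unfolding R_def by blast
  have R: "x \<in> Q \<longleftrightarrow> (\<exists>s. x \<in> R s)" for x
    using a unfolding sem_def R_def by blast
  \<comment> \<open>The two quantifiers put the stage bound and the level in front of the arguments,
    in the order in which \<open>Refute\<close> reads them: bound, level, index, witness.\<close>
  define c where "c = Exi (Exi (Fn True (Refute (to_nat a))))"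
  define e where "e = to_nat c"
  have c: "sem c [i, v] \<longleftrightarrow> (\<exists>t s. refuted sems a s t i v)" for i v
  proof -
    have "refuted (\<lambda>s' q y. s' < s \<and> sems s' q y) a s' t i v \<longleftrightarrow> refuted sems a s' t i v"
      if "s' < s" for s s' t
      using that by (simp add: refuted_def)
    then have "sem c [i, v] \<longleftrightarrow> (\<exists>t s. \<exists>s'<s. refuted sems a s' t i v)"
      by (simp add: c_def sem_Exi sem_Fn env_def cong: conj_cong)
    then show ?thesis by blast
  qed
  have T: "i \<in> total_codes \<longleftrightarrow> (\<forall>n. sem (from_nat i) [i, n])" for i
    by (simp add: total_codes_def)
  show False
  proof (cases "e \<in> total_codes")
    case True
    \<comment> \<open>Every witness for \<open>e\<close> is refuted. This clashes with the truthful
      witness, built from the actual members below \<open>e\<close>.\<close>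
    let ?F = "total_codes \<inter> {..<e}"
    obtain fl where fl: "set fl = ?F"
      using finite_list[of ?F] by auto
    \<comment> \<open>Inside \<open>?F\<close> the chosen number is arbitrary;
      \<open>refuted\<close> consults \<open>w\<close> only outside of the guessed set.\<close>
    define w where "w = map (\<lambda>i. SOME n. \<not> sem (from_nat i) [i, n]) [0..<e]"
    have w: "\<not> sem (from_nat i) [i, env w i]" if "i < e" "i \<notin> ?F" for i
    proof -
      have ex: "\<exists>n. \<not> sem (from_nat i) [i, n]" using that T by auto
      then show ?thesis using that(1) someI_ex[OF ex] by (simp add: w_def env_def)
    qed
    have "total_codes \<inter> {..<Suc e} = insert e ?F" using True by (auto simp: less_Suc_eq)
    then have "weight (total_codes \<inter> {..<Suc e}) = weight ?F + 1 / 2 ^ (3 * e + 1)"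
      by (simp add: weight_def)
    then have "gge cylinders (weight ?F + 1 / 2 ^ (3 * e + 1))"
      using gge_cylinders[of "Suc e"] by simp
    then have "gle Q (1 - (weight ?F + 1 / 2 ^ (3 * e + 1)))"
      by (subst measure) (simp_all add: weight_Rats)
    \<comment> \<open>\<open>gle\<close> yields a finite intersection only for bounds strictly above
      its argument; halving the contribution of \<open>e\<close> provides the slack.\<close>
    moreover have "1 - (weight ?F + 1 / 2 ^ (3 * e + 1)) < 1 - (weight ?F + 1 / 2 ^ (3 * e + 2))"
      by (simp add: field_simps)
    ultimately obtain n where n: "ole (inter_set Q n) (1 - (weight ?F + 1 / 2 ^ (3 * e + 2)))"
      unfolding gle_def using weight_Rats by (meson Rats_1 Rats_add Rats_diff Rats_divide Rats_number_of Rats_power)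
    have "sem c [e, to_nat (fl, n, w)]"
      using True T[of e] by (simp add: e_def)
    then obtain t s where "refuted sems a s t e (to_nat (fl, n, w))"
      using c by blast
    then consider i where "i < e" "i \<notin> ?F" "sems s (from_nat i) [i, env w i]"
      | "real (cnt (inter_set (R s) n) t) / 2 ^ t > 1 - (weight ?F + 1 / 2 ^ (3 * e + 2))"
      by (auto simp: refuted_def fl R_def)
    then show False
    proof cases
      case 1
      with w show False unfolding sem_def by blast
    next
      case 2
      have "R s \<subseteq> Q" using R by blast
      then have "real (cnt (inter_set (R s) n) t) / 2 ^ t \<le> real (cnt (inter_set Q n) t) / 2 ^ t"
        by (intro divide_right_mono of_nat_mono cnt_mono inter_set_mono) auto
      with n 2 show False unfolding ole_def by (meson leD order_trans)
    qed
  next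
    case False
    \<comment> \<open>A witness that is never refuted forces the set coded by \<open>Q\<close>, and
      by equality also the cylinders, to have measure at least \<open>?q\<close>. This is too much
      if \<open>e\<close> is not a member.\<close>
    then obtain v where v: "\<not> sem c [e, v]"
      using T[of e] by (auto simp: e_def)
    obtain fl n w where fl: "from_nat v = (fl :: nat list, n :: nat, w :: nat list)"
      by (metis prod_cases3)
    let ?q = "weight (set fl) + 1 / 2 ^ (3 * e + 2)"
    have "\<not> refuted sems a s t e v" for s t using v c by blast
    then have "set fl \<subseteq> {..<e}
      \<and> (\<forall>i<e. i \<notin> set fl \<longrightarrow> \<not> sems s (from_nat i) [i, env w i])
      \<and> real (cnt (inter_set (R s) n) t) / 2 ^ t \<le> 1 - ?q" for s t
      unfolding refuted_def fl R_def prod.case de_Morgan_disj not_less by blast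
    then have v: "set fl \<subseteq> {..<e}"
      "\<And>i s. i < e \<Longrightarrow> i \<notin> set fl \<Longrightarrow> \<not> sems s (from_nat i) [i, env w i]"
      "\<And>s t. real (cnt (inter_set (R s) n) t) / 2 ^ t \<le> 1 - ?q"
      by blast+
    have "ole (inter_set Q n) (1 - ?q)"
      unfolding ole_def
    proof
      fix t
      obtain s where "cnt (inter_set Q n) t \<le> cnt (inter_set (R s) n) t"
        using cnt_inter_stage[OF R R_mono] by blast
      then have "real (cnt (inter_set Q n) t) / 2 ^ t \<le> real (cnt (inter_set (R s) n) t) / 2 ^ t"
        by (intro divide_right_mono) auto
      also note v(3)
      finally show "real (cnt (inter_set Q n) t) / 2 ^ t \<le> 1 - ?q" .
    qed
    then have "gle Q (1 - ?q)"
      unfolding gle_def ole_def by (meson less_imp_le order_trans)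
    then have "gge cylinders ?q"
      by (subst (asm) measure) (simp_all add: weight_Rats)
    \<comment> \<open>The counterexamples in \<open>w\<close> ensure that \<open>set fl\<close>
      contains every member below \<open>e\<close>, as the upper bound requires.\<close>
    moreover obtain m where "ole (inter_set cylinders m) (weight (set fl) + 1 / 2 ^ (3 * e + 3))"
      using ole_inter_cylinders[OF False _ v(1)] v(2) T unfolding sem_def by blast
    moreover have "weight (set fl) + 1 / 2 ^ (3 * e + 3) < ?q"
      by (simp add: power_add field_simps)
    moreover have "weight (set fl) + 1 / 2 ^ (3 * e + 3) \<in> \<rat>"
      by (simp add: weight_Rats)
    ultimately show False
      unfolding gge_def oge_def by blast
  qed
qed

theorem corollary5p5:
  shows "\<not> RCA0 \<turnstile> Imp POS Gdelta_REG \<and> \<not> RCA0 \<turnstile> Imp Gdelta_eps Gdelta_REG"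
  using RCA0_sound Rec_POS Rec_Gdelta_eps Rec_not_Gdelta_REG sat.simps(5) by blast

end
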